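(* The functor $\mathcal{UC}\colon\mathbf{sT}\to\mathbf{gBa}$, $G\mapsto\mathcal{UC}(G)$ (acting on morphisms by restriction), is an equivalence of categories.
   Context: All vector lattices are real. A truncation on an archimedean vector lattice $G$ is a unary operation $g\mapsto\overline g$ on $G^+$ such that for all $g,h\in G^+$: $g\wedge\overline h\le\overline g\le g$; if $\overline g=0$ then $g=0$; if $ng=\overline{ng}$ for all positive integers $n$ then $g=0$. A trunc is an archimedean vector lattice with a truncation; a truncation homomorphism is a vector lattice homomorphism preserving truncation. $\mathbf T$ is the category of truncs and truncation homomorphisms. $\overline G=\{\overline g:g\in G^+\}$. For $f,g\in G^+$, $f$ is a component of $g$ if $f\le g$ and $f\wedge(g-f)=0$. A unital component of $G$ is an element $u\in\overline G$ such that $u\wedge g$ is a component of $g$ for every $g\in\overline G$; $\mathcal{UC}(G)$ is the set of unital components. (Known: for $u\in G^+$, $u$ is a unital component iff $u=\overline{2u}$; with the order of $G$, $\mathcal{UC}(G)$ is a generalized Boolean algebra with bottom $0$.) A trunc is simple if every element is a (finite real) linear combination of unital components. $\mathbf{sT}$ is the full subcategory of $\mathbf T$ of simple truncs. $\mathbf{gBa}$ is the category of generalized Boolean algebras (distributive lattices with designated bottom $\bot$ such that for all $a,b$ there is $c$ with $c\vee b=a\vee b$ and $c\wedge b=\bot$) and lattice homomorphisms preserving $\bot$. *)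

theory Defs
  imports "HOL-Algebra.Algebra" "HOL-Algebra.Algebraic_Closure_Type" "HOL-Library.FuncSet"
begin

section \<open>Categories, functors and equivalences\<close>

text \<open>
  Hom-sets need not be disjoint, so identities, composition and the action of a functor on
  morphisms are indexed by the objects involved: for \<open>f \<in> Hom C x y\<close> and \<open>g \<in> Hom C y z\<close>,
  \<open>Comp C x y z g f\<close> is ``\<open>g\<close> after \<open>f\<close>''.
\<close>

record ('o, 'm) cat =
  Obj :: "'o set"
  Hom :: "'o \<Rightarrow> 'o \<Rightarrow> 'm set"
  Id :: "'o \<Rightarrow> 'm"
  Comp :: "'o \<Rightarrow> 'o \<Rightarrow> 'o \<Rightarrow> 'm \<Rightarrow> 'm \<Rightarrow> 'm"

locale category =
  fixes C :: "('o, 'm) cat"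
  assumes Id_in_Hom: "x \<in> Obj C \<Longrightarrow> Id C x \<in> Hom C x x"
    and Comp_in_Hom: "\<lbrakk>x \<in> Obj C; y \<in> Obj C; z \<in> Obj C; f \<in> Hom C x y; g \<in> Hom C y z\<rbrakk>
      \<Longrightarrow> Comp C x y z g f \<in> Hom C x z"
    and Comp_Id: "\<lbrakk>x \<in> Obj C; y \<in> Obj C; f \<in> Hom C x y\<rbrakk> \<Longrightarrow> Comp C x x y f (Id C x) = f"
    and Id_Comp: "\<lbrakk>x \<in> Obj C; y \<in> Obj C; f \<in> Hom C x y\<rbrakk> \<Longrightarrow> Comp C x y y (Id C y) f = f"
    and Comp_assoc: "\<lbrakk>w \<in> Obj C; x \<in> Obj C; y \<in> Obj C; z \<in> Obj C;
        f \<in> Hom C w x; g \<in> Hom C x y; h \<in> Hom C y z\<rbrakk>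
      \<Longrightarrow> Comp C w x z (Comp C x y z h g) f = Comp C w y z h (Comp C w x y g f)"

definition iso_in :: "('o, 'm) cat \<Rightarrow> 'o \<Rightarrow> 'o \<Rightarrow> 'm \<Rightarrow> bool" where
  "iso_in C x y f \<longleftrightarrow> f \<in> Hom C x y \<and>
     (\<exists>g \<in> Hom C y x. Comp C x y x g f = Id C x \<and> Comp C y x y f g = Id C y)"

definition full_subcategory :: "('o, 'm) cat \<Rightarrow> ('o \<Rightarrow> bool) \<Rightarrow> ('o, 'm) cat" where
  "full_subcategory C P = C\<lparr>Obj := {x \<in> Obj C. P x}\<rparr>"

record ('o1, 'm1, 'o2, 'm2) functor_data =
  FObj :: "'o1 \<Rightarrow> 'o2"
  FMap :: "'o1 \<Rightarrow> 'o1 \<Rightarrow> 'm1 \<Rightarrow> 'm2"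

locale cat_functor = C: category C + D: category D
  for C :: "('o1, 'm1) cat" and D :: "('o2, 'm2) cat" +
  fixes F :: "('o1, 'm1, 'o2, 'm2) functor_data"
  assumes FObj_in_Obj: "x \<in> Obj C \<Longrightarrow> FObj F x \<in> Obj D"
    and FMap_in_Hom: "\<lbrakk>x \<in> Obj C; y \<in> Obj C; f \<in> Hom C x y\<rbrakk>
      \<Longrightarrow> FMap F x y f \<in> Hom D (FObj F x) (FObj F y)"
    and FMap_Id: "x \<in> Obj C \<Longrightarrow> FMap F x x (Id C x) = Id D (FObj F x)"
    and FMap_Comp: "\<lbrakk>x \<in> Obj C; y \<in> Obj C; z \<in> Obj C; f \<in> Hom C x y; g \<in> Hom C y z\<rbrakk>
      \<Longrightarrow> FMap F x z (Comp C x y z g f)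
        = Comp D (FObj F x) (FObj F y) (FObj F z) (FMap F y z g) (FMap F x y f)"

definition id_functor :: "('o, 'm, 'o, 'm) functor_data" where
  "id_functor = \<lparr>FObj = (\<lambda>x. x), FMap = (\<lambda>x y f. f)\<rparr>"

definition comp_functor :: "('o2, 'm2, 'o3, 'm3) functor_data \<Rightarrow>
    ('o1, 'm1, 'o2, 'm2) functor_data \<Rightarrow> ('o1, 'm1, 'o3, 'm3) functor_data" where
  "comp_functor G F =
     \<lparr>FObj = (\<lambda>x. FObj G (FObj F x)),
      FMap = (\<lambda>x y f. FMap G (FObj F x) (FObj F y) (FMap F x y f))\<rparr>"

locale natural_isomorphism = F: cat_functor C D F + G: cat_functor C D G
  for C :: "('o1, 'm1) cat" and D :: "('o2, 'm2) cat"
    and F :: "('o1, 'm1, 'o2, 'm2) functor_data" and G :: "('o1, 'm1, 'o2, 'm2) functor_data" +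
  fixes \<eta> :: "'o1 \<Rightarrow> 'm2"
  assumes component_iso: "x \<in> Obj C \<Longrightarrow> iso_in D (FObj F x) (FObj G x) (\<eta> x)"
    and naturality: "\<lbrakk>x \<in> Obj C; y \<in> Obj C; f \<in> Hom C x y\<rbrakk>
      \<Longrightarrow> Comp D (FObj F x) (FObj F y) (FObj G y) (\<eta> y) (FMap F x y f)
        = Comp D (FObj F x) (FObj G x) (FObj G y) (FMap G x y f) (\<eta> x)"

definition equivalence_of_categories ::
    "('o1, 'm1) cat \<Rightarrow> ('o2, 'm2) cat \<Rightarrow> ('o1, 'm1, 'o2, 'm2) functor_data \<Rightarrow> bool" where
  "equivalence_of_categories C D F \<longleftrightarrow> cat_functor C D F \<and>
     (\<exists>G \<eta> \<epsilon>. cat_functor D C G \<and>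
        natural_isomorphism C C id_functor (comp_functor G F) \<eta> \<and>
        natural_isomorphism D D (comp_functor F G) id_functor \<epsilon>)"


section \<open>Vector lattices and truncs\<close>

text \<open>
  The fields \<open>mult\<close> and \<open>one\<close> inherited from the ring record of the library's modules are not used,
  and only the values of the operations on the carrier matter.  Structures that agree on their
  carrier are isomorphic (via the identity) in the categories below.
\<close>

record 'a vlat = "(real, 'a) module" +
  vle :: "'a \<Rightarrow> 'a \<Rightarrow> bool"  (infix "\<preceq>\<index>" 50)

definition vorder :: "('a, 'm) vlat_scheme \<Rightarrow> 'a gorder" where
  "vorder G = \<lparr>carrier = carrier G, eq = (=), le = vle G\<rparr>"

abbreviation vmeet :: "('a, 'm) vlat_scheme \<Rightarrow> 'a \<Rightarrow> 'a \<Rightarrow> 'a" (infixl "\<triangle>\<index>" 60) where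
  "x \<triangle>\<^bsub>G\<^esub> y \<equiv> x \<sqinter>\<^bsub>vorder G\<^esub> y"

abbreviation vjoin :: "('a, 'm) vlat_scheme \<Rightarrow> 'a \<Rightarrow> 'a \<Rightarrow> 'a" (infixl "\<nabla>\<index>" 55) where
  "x \<nabla>\<^bsub>G\<^esub> y \<equiv> x \<squnion>\<^bsub>vorder G\<^esub> y"

definition pos :: "('a, 'm) vlat_scheme \<Rightarrow> 'a set" where
  "pos G = {x \<in> carrier G. \<zero>\<^bsub>G\<^esub> \<preceq>\<^bsub>G\<^esub> x}"

locale vector_lattice =
  module "ring_of_type_algebra :: real ring" G + ord: lattice "vorder G"
  for G :: "('a, 'm) vlat_scheme" (structure) +
  assumes add_mono: "\<lbrakk>x \<in> carrier G; y \<in> carrier G; z \<in> carrier G; x \<preceq> y\<rbrakk>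
      \<Longrightarrow> x \<oplus> z \<preceq> y \<oplus> z"
    and smult_pos: "\<lbrakk>x \<in> pos G; (0::real) \<le> r\<rbrakk> \<Longrightarrow> \<zero> \<preceq> r \<odot> x"

locale archimedean_vector_lattice = vector_lattice +
  assumes archimedean:
    "\<lbrakk>x \<in> pos G; y \<in> pos G; \<And>n::nat. 0 < n \<Longrightarrow> real n \<odot> x \<preceq> y\<rbrakk> \<Longrightarrow> x = \<zero>"

record 'a trunc = "'a vlat" +
  truncation :: "'a \<Rightarrow> 'a"

locale trunc = archimedean_vector_lattice G
  for G :: "('a, 'm) trunc_scheme" (structure) +
  assumes truncation_closed: "g \<in> pos G \<Longrightarrow> truncation G g \<in> pos G"
    and truncation_lower: "\<lbrakk>g \<in> pos G; h \<in> pos G\<rbrakk> \<Longrightarrow> g \<triangle> truncation G h \<preceq> truncation G g"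
    and truncation_upper: "g \<in> pos G \<Longrightarrow> truncation G g \<preceq> g"
    and truncation_eq_zero: "\<lbrakk>g \<in> pos G; truncation G g = \<zero>\<rbrakk> \<Longrightarrow> g = \<zero>"
    and truncation_bounded:
      "\<lbrakk>g \<in> pos G; \<And>n::nat. 0 < n \<Longrightarrow> real n \<odot> g = truncation G (real n \<odot> g)\<rbrakk> \<Longrightarrow> g = \<zero>"

text \<open>
  Maps are taken to be extensional (\<open>undefined\<close> off the domain's carrier), so that equality of
  morphisms is equality of functions on the carrier.
\<close>

definition vlat_hom :: "('a, 'm) vlat_scheme \<Rightarrow> ('b, 'n) vlat_scheme \<Rightarrow> ('a \<Rightarrow> 'b) set" where
  "vlat_hom G H = {f \<in> carrier G \<rightarrow>\<^sub>E carrier H.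
     (\<forall>x \<in> carrier G. \<forall>y \<in> carrier G. f (x \<oplus>\<^bsub>G\<^esub> y) = f x \<oplus>\<^bsub>H\<^esub> f y) \<and>
     (\<forall>r. \<forall>x \<in> carrier G. f (r \<odot>\<^bsub>G\<^esub> x) = r \<odot>\<^bsub>H\<^esub> f x) \<and>
     (\<forall>x \<in> carrier G. \<forall>y \<in> carrier G. f (x \<triangle>\<^bsub>G\<^esub> y) = f x \<triangle>\<^bsub>H\<^esub> f y) \<and>
     (\<forall>x \<in> carrier G. \<forall>y \<in> carrier G. f (x \<nabla>\<^bsub>G\<^esub> y) = f x \<nabla>\<^bsub>H\<^esub> f y)}"

definition trunc_hom :: "('a, 'm) trunc_scheme \<Rightarrow> ('b, 'n) trunc_scheme \<Rightarrow> ('a \<Rightarrow> 'b) set" where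
  "trunc_hom G H =
     {f \<in> vlat_hom G H. \<forall>g \<in> pos G. f (truncation G g) = truncation H (f g)}"

definition truncs_cat :: "('u trunc, 'u \<Rightarrow> 'u) cat" where
  "truncs_cat =
     \<lparr>Obj = {G. trunc G}, Hom = trunc_hom,
      Id = (\<lambda>G. \<lambda>x \<in> carrier G. x), Comp = (\<lambda>G H K g f. compose (carrier G) g f)\<rparr>"

definition truncated_elements :: "('a, 'm) trunc_scheme \<Rightarrow> 'a set" where
  "truncated_elements G = truncation G ` pos G"

definition is_component :: "('a, 'm) vlat_scheme \<Rightarrow> 'a \<Rightarrow> 'a \<Rightarrow> bool" where
  "is_component G f g \<longleftrightarrow> f \<in> pos G \<and> g \<in> pos G \<and>
     f \<preceq>\<^bsub>G\<^esub> g \<and> f \<triangle>\<^bsub>G\<^esub> (g \<ominus>\<^bsub>G\<^esub> f) = \<zero>\<^bsub>G\<^esub>"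

definition unital_components :: "('a, 'm) trunc_scheme \<Rightarrow> 'a set" where
  "unital_components G = {u \<in> truncated_elements G.
     \<forall>g \<in> truncated_elements G. is_component G (u \<triangle>\<^bsub>G\<^esub> g) g}"

definition simple_trunc :: "('a, 'm) trunc_scheme \<Rightarrow> bool" where
  "simple_trunc G \<longleftrightarrow> (\<forall>g \<in> carrier G. \<exists>U c. finite U \<and> U \<subseteq> unital_components G \<and>
     g = (\<Oplus>\<^bsub>G\<^esub>u\<in>U. (c u :: real) \<odot>\<^bsub>G\<^esub> u))"

text \<open>
  The objects of \<open>truncs_cat\<close>, \<open>simple_truncs_cat\<close> and \<open>gba_cat\<close> are the structures whose carrier
  is a subset of the type \<open>'u\<close>, which plays the role of the universe.  A universe has to be large
  enough for the constructions made in it: a nonzero trunc has at least continuum many elements,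
  so an equivalence with the (nontrivial) generalized Boolean algebras in \<open>'u\<close> needs \<open>'u\<close> to contain a copy of the
  reals.
\<close>

definition simple_truncs_cat :: "('u trunc, 'u \<Rightarrow> 'u) cat" where
  "simple_truncs_cat = full_subcategory truncs_cat simple_trunc"


section \<open>Generalized Boolean algebras\<close>

text \<open>
  The designated bottom is not a separate field: it is the least element, which the order
  determines, and is denoted \<open>\<bottom>\<^bsub>L\<^esub>\<close>.
\<close>

locale generalized_boolean_algebra = lattice L + weak_partial_order_bottom L
  for L :: "('a, 'm) gorder_scheme" (structure) +
  assumes distrib: "\<lbrakk>a \<in> carrier L; b \<in> carrier L; c \<in> carrier L\<rbrakk>
      \<Longrightarrow> a \<sqinter> (b \<squnion> c) = (a \<sqinter> b) \<squnion> (a \<sqinter> c)"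
    and relative_complement: "\<lbrakk>a \<in> carrier L; b \<in> carrier L\<rbrakk>
      \<Longrightarrow> \<exists>c \<in> carrier L. c \<squnion> b = a \<squnion> b \<and> c \<sqinter> b = \<bottom>"

definition gba_hom :: "('a, 'm) gorder_scheme \<Rightarrow> ('b, 'n) gorder_scheme \<Rightarrow> ('a \<Rightarrow> 'b) set" where
  "gba_hom L M = {f \<in> carrier L \<rightarrow>\<^sub>E carrier M.
     (\<forall>x \<in> carrier L. \<forall>y \<in> carrier L. f (x \<sqinter>\<^bsub>L\<^esub> y) = f x \<sqinter>\<^bsub>M\<^esub> f y) \<and>
     (\<forall>x \<in> carrier L. \<forall>y \<in> carrier L. f (x \<squnion>\<^bsub>L\<^esub> y) = f x \<squnion>\<^bsub>M\<^esub> f y) \<and>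
     f \<bottom>\<^bsub>L\<^esub> = \<bottom>\<^bsub>M\<^esub>}"

definition gba_cat :: "('u gorder, 'u \<Rightarrow> 'u) cat" where
  "gba_cat =
     \<lparr>Obj = {L. generalized_boolean_algebra L}, Hom = gba_hom,
      Id = (\<lambda>L. \<lambda>x \<in> carrier L. x), Comp = (\<lambda>L M N g f. compose (carrier L) g f)\<rparr>"


section \<open>The functor of unital components\<close>

definition UC :: "('u trunc, 'u \<Rightarrow> 'u, 'u gorder, 'u \<Rightarrow> 'u) functor_data" where
  "UC =
     \<lparr>FObj = (\<lambda>G. (vorder G)\<lparr>carrier := unital_components G\<rparr>),
      FMap = (\<lambda>G H f. restrict f (unital_components G))\<rparr>"

end

theory Submission
  imports Defs "HOL-Library.Indicator_Function"
begin

text \<open>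
  Let \<open>p\<close> be a prime filter of unital components of a simple trunc \<open>G\<close>.  Every \<open>g\<close> agrees with
  exactly one real multiple \<open>r u\<close> on some \<open>u \<in> p\<close>, up to an error disjoint from \<open>u\<close>, and \<open>g \<mapsto> r\<close>
  is a truncation homomorphism into the reals.  By the prime ideal theorem these evaluations jointly
  separate the points of \<open>G\<close>, so all identities can be checked pointwise: a homomorphism \<open>\<phi>\<close> of
  generalized Boolean algebras extends to truncs through the evaluations at \<open>\<phi>\<^sup>-\<^sup>1(q)\<close>, uniquely since
  the unital components span.  Conversely a generalized Boolean algebra \<open>L\<close> is the algebra of unital
  components of the trunc of step functions over the ring of sets representing \<open>L\<close>; such a function
  is a finite set of pairs in \<open>\<real> \<times> L\<close>, so the universe has room for all of them.
\<close>

section \<open>Vector lattices\<close>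

text \<open>Linear combinations of unital components are far from unique, so extending a
  homomorphism linearly would raise a question of well-definedness. Agreement avoids it: it is a
  relation between elements and reals that is stable under all operations, and uniqueness of the
  real is a separate disjointness argument. By stability, existence of the real reduces to a single
  unital component, where a relative complement decides between the values 0 and 1. Separation of
  points rests on one ideal, the unital components disjoint from a given positive element: a
  nonempty prime avoiding it cannot evaluate the element to 0. Two features shape the constructions.
  A generalized Boolean algebra need not have a top, so preimages of primes can be empty, the
  constant 1 need not be a step function, and the zero level of a step function need not belong to
  the ring of sets. And all objects live in one type, so functions on sets of elements have to be
  coded by elements.\<close>

lemma real_ring_simps:
  "carrier (ring_of_type_algebra :: real ring) = UNIV"
  "(x :: real) \<oplus>\<^bsub>ring_of_type_algebra\<^esub> y = x + y"
  "(x :: real) \<otimes>\<^bsub>ring_of_type_algebra\<^esub> y = x * y"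
  "\<zero>\<^bsub>ring_of_type_algebra\<^esub> = (0 :: real)"
  "\<one>\<^bsub>ring_of_type_algebra\<^esub> = (1 :: real)"
  by (simp_all add: ring_of_type_algebra_def)

context vector_lattice
begin

text \<open>The scalars form a record-based ring on the type \<open>real\<close>. The module axioms
  are restated here in ordinary real arithmetic, so that the record does not appear again in
  calculations.\<close>

lemma vsmult_closed [simp, intro]: "x \<in> carrier G \<Longrightarrow> (r::real) \<odot> x \<in> carrier G"
  using smult_closed[of r x] by (simp only: real_ring_simps UNIV_I simp_thms)

lemma smult_add_left: "x \<in> carrier G \<Longrightarrow> (r + s::real) \<odot> x = r \<odot> x \<oplus> s \<odot> x"
  using smult_l_distr[of r s x] by (simp only: real_ring_simps UNIV_I simp_thms)

lemma smult_add_right: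
  "\<lbrakk>x \<in> carrier G; y \<in> carrier G\<rbrakk> \<Longrightarrow> (r::real) \<odot> (x \<oplus> y) = r \<odot> x \<oplus> r \<odot> y"
  using smult_r_distr[of r x y] by (simp only: real_ring_simps UNIV_I simp_thms)

lemma smult_smult: "x \<in> carrier G \<Longrightarrow> (r::real) \<odot> (s \<odot> x) = (r * s) \<odot> x"
  using smult_assoc1[of r s x] by (simp only: real_ring_simps UNIV_I simp_thms)

lemma smult_1 [simp]: "x \<in> carrier G \<Longrightarrow> (1::real) \<odot> x = x"
  using smult_one[of x] by (simp only: real_ring_simps UNIV_I simp_thms)

lemma smult_0_left [simp]: "x \<in> carrier G \<Longrightarrow> (0::real) \<odot> x = \<zero>"
  using smult_l_null[of x] by (simp only: real_ring_simps UNIV_I simp_thms)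

lemma smult_0_right [simp]: "(r::real) \<odot> \<zero> = \<zero>"
  using smult_r_null[of r] by (simp only: real_ring_simps UNIV_I simp_thms)

lemma smult_minus1: "x \<in> carrier G \<Longrightarrow> (-1::real) \<odot> x = \<ominus> x"
  using smult_add_left[of x "-1" 1] by (simp add: M.minus_equality)

lemma smult_2: "x \<in> carrier G \<Longrightarrow> (2::real) \<odot> x = x \<oplus> x"
  using smult_add_left[of x 1 1] by simp

section \<open>Order, meets and joins on the carrier\<close>

lemma vle_refl [simp]: "x \<in> carrier G \<Longrightarrow> x \<preceq> x"
  using ord.le_refl[of x] by (simp add: vorder_def)

lemma vle_trans [trans]:
  "\<lbrakk>x \<preceq> y; y \<preceq> z; x \<in> carrier G; y \<in> carrier G; z \<in> carrier G\<rbrakk> \<Longrightarrow> x \<preceq> z"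
  using ord.le_trans[of x y z] by (simp add: vorder_def)

lemma vle_antisym:
  "\<lbrakk>x \<preceq> y; y \<preceq> x; x \<in> carrier G; y \<in> carrier G\<rbrakk> \<Longrightarrow> x = y"
  using ord.le_antisym[of x y] by (simp add: vorder_def)

lemma vmeet_closed [simp, intro]: "\<lbrakk>x \<in> carrier G; y \<in> carrier G\<rbrakk> \<Longrightarrow> x \<triangle> y \<in> carrier G"
  using ord.meet_closed[of x y] by (simp add: vorder_def)

lemma vjoin_closed [simp, intro]: "\<lbrakk>x \<in> carrier G; y \<in> carrier G\<rbrakk> \<Longrightarrow> x \<nabla> y \<in> carrier G"
  using ord.join_closed[of x y] by (simp add: vorder_def)

lemma vmeet_left: "\<lbrakk>x \<in> carrier G; y \<in> carrier G\<rbrakk> \<Longrightarrow> x \<triangle> y \<preceq> x"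
  using ord.meet_left[of x y] by (simp add: vorder_def)

lemma vmeet_right: "\<lbrakk>x \<in> carrier G; y \<in> carrier G\<rbrakk> \<Longrightarrow> x \<triangle> y \<preceq> y"
  using ord.meet_right[of x y] by (simp add: vorder_def)

lemma vmeet_greatest:
  "\<lbrakk>z \<preceq> x; z \<preceq> y; x \<in> carrier G; y \<in> carrier G; z \<in> carrier G\<rbrakk> \<Longrightarrow> z \<preceq> x \<triangle> y"
  using ord.meet_le[of z x y] by (simp add: vorder_def)

lemma vjoin_left: "\<lbrakk>x \<in> carrier G; y \<in> carrier G\<rbrakk> \<Longrightarrow> x \<preceq> x \<nabla> y"
  using ord.join_left[of x y] by (simp add: vorder_def)

lemma vjoin_right: "\<lbrakk>x \<in> carrier G; y \<in> carrier G\<rbrakk> \<Longrightarrow> y \<preceq> x \<nabla> y"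
  using ord.join_right[of x y] by (simp add: vorder_def)

lemma vjoin_least:
  "\<lbrakk>x \<preceq> z; y \<preceq> z; x \<in> carrier G; y \<in> carrier G; z \<in> carrier G\<rbrakk> \<Longrightarrow> x \<nabla> y \<preceq> z"
  using ord.join_le[of x z y] by (simp add: vorder_def)

lemma vmeet_commute: "x \<triangle> y = y \<triangle> x"
  by (rule meet_comm)

lemma vmeet_eqI:
  "\<lbrakk>z \<preceq> x; z \<preceq> y; \<And>w. \<lbrakk>w \<in> carrier G; w \<preceq> x; w \<preceq> y\<rbrakk> \<Longrightarrow> w \<preceq> z;
    x \<in> carrier G; y \<in> carrier G; z \<in> carrier G\<rbrakk> \<Longrightarrow> x \<triangle> y = z"
  by (meson vle_antisym vmeet_closed vmeet_greatest vmeet_left vmeet_right)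

lemma vjoin_eqI:
  "\<lbrakk>x \<preceq> z; y \<preceq> z; \<And>w. \<lbrakk>w \<in> carrier G; x \<preceq> w; y \<preceq> w\<rbrakk> \<Longrightarrow> z \<preceq> w;
    x \<in> carrier G; y \<in> carrier G; z \<in> carrier G\<rbrakk> \<Longrightarrow> x \<nabla> y = z"
  by (meson vle_antisym vjoin_closed vjoin_least vjoin_left vjoin_right)

lemma vmeet_absorb1: "\<lbrakk>x \<preceq> y; x \<in> carrier G; y \<in> carrier G\<rbrakk> \<Longrightarrow> x \<triangle> y = x"
  by (rule vmeet_eqI) auto

lemma vmeet_absorb2: "\<lbrakk>y \<preceq> x; x \<in> carrier G; y \<in> carrier G\<rbrakk> \<Longrightarrow> x \<triangle> y = y"
  by (rule vmeet_eqI) auto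

lemma vjoin_absorb2: "\<lbrakk>x \<preceq> y; x \<in> carrier G; y \<in> carrier G\<rbrakk> \<Longrightarrow> x \<nabla> y = y"
  by (rule vjoin_eqI) auto

lemma vmeet_mono:
  "\<lbrakk>x \<preceq> x'; y \<preceq> y'; x \<in> carrier G; x' \<in> carrier G; y \<in> carrier G; y' \<in> carrier G\<rbrakk>
    \<Longrightarrow> x \<triangle> y \<preceq> x' \<triangle> y'"
  by (meson vle_trans vmeet_closed vmeet_greatest vmeet_left vmeet_right)

lemma vmeet_assoc:
  assumes [simp]: "x \<in> carrier G" "y \<in> carrier G" "z \<in> carrier G"
  shows "(x \<triangle> y) \<triangle> z = x \<triangle> (y \<triangle> z)"
  using ord.weak_meet_assoc[of x y z] by (simp add: vorder_def)

lemma pos_carrier [simp]: "x \<in> pos G \<Longrightarrow> x \<in> carrier G"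
  by (simp add: pos_def)

lemma pos_ge_0: "x \<in> pos G \<Longrightarrow> \<zero> \<preceq> x"
  by (simp add: pos_def del: pos_carrier)

lemma zero_pos [simp]: "\<zero> \<in> pos G"
  by (simp add: pos_def del: pos_carrier)

lemma pos_upward: "\<lbrakk>x \<in> pos G; x \<preceq> y; y \<in> carrier G\<rbrakk> \<Longrightarrow> y \<in> pos G"
  using vle_trans[of \<zero> x y] unfolding pos_def by blast

lemma pos_smult [simp, intro]: "\<lbrakk>x \<in> pos G; 0 \<le> (r::real)\<rbrakk> \<Longrightarrow> r \<odot> x \<in> pos G"
  using smult_pos[of x r] by (simp add: pos_def del: pos_carrier)

lemma pos_vmeet [simp, intro]: "\<lbrakk>x \<in> pos G; y \<in> pos G\<rbrakk> \<Longrightarrow> x \<triangle> y \<in> pos G"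
  by (simp add: pos_def vmeet_greatest del: pos_carrier)

lemma pos_vjoin [simp, intro]: "\<lbrakk>x \<in> pos G; y \<in> carrier G\<rbrakk> \<Longrightarrow> x \<nabla> y \<in> pos G"
  by (rule pos_upward[of x]) (auto intro: vjoin_left)

section \<open>Compatibility of the order with addition and scaling\<close>

lemma add_le_cancel_right:
  assumes [simp]: "x \<in> carrier G" "y \<in> carrier G" "z \<in> carrier G"
  shows "x \<oplus> z \<preceq> y \<oplus> z \<longleftrightarrow> x \<preceq> y"
  using add_mono[of x y z] add_mono[of "x \<oplus> z" "y \<oplus> z" "\<ominus> z"]
  by (auto simp: M.a_assoc M.r_neg)

lemma add_le_cancel_left:
  assumes [simp]: "x \<in> carrier G" "y \<in> carrier G" "z \<in> carrier G"
  shows "z \<oplus> x \<preceq> z \<oplus> y \<longleftrightarrow> x \<preceq> y"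
  using add_le_cancel_right[of x y z] by (simp add: M.a_comm)

lemma add_mono2:
  assumes "x \<preceq> x'" "y \<preceq> y'"
    and [simp]: "x \<in> carrier G" "x' \<in> carrier G" "y \<in> carrier G" "y' \<in> carrier G"
  shows "x \<oplus> y \<preceq> x' \<oplus> y'"
proof -
  have "x \<oplus> y \<preceq> x' \<oplus> y" using assms by (simp add: add_le_cancel_right)
  also have "\<dots> \<preceq> x' \<oplus> y'" using assms by (simp add: add_le_cancel_left)
  finally show ?thesis by simp
qed

lemma pos_add [simp, intro]: "\<lbrakk>x \<in> pos G; y \<in> pos G\<rbrakk> \<Longrightarrow> x \<oplus> y \<in> pos G"
  using add_mono2[of \<zero> x \<zero> y] by (simp add: pos_def del: pos_carrier)

lemma le_add_pos1: "\<lbrakk>x \<in> carrier G; y \<in> pos G\<rbrakk> \<Longrightarrow> x \<preceq> x \<oplus> y"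
  using add_le_cancel_left[of \<zero> y x] by (simp add: pos_def del: pos_carrier)

lemma le_add_pos2: "\<lbrakk>x \<in> carrier G; y \<in> pos G\<rbrakk> \<Longrightarrow> x \<preceq> y \<oplus> x"
  using le_add_pos1 by (simp add: M.a_comm)

lemma diff_add_cancel [simp]:
  assumes [simp]: "x \<in> carrier G" "y \<in> carrier G"
  shows "(x \<ominus> y) \<oplus> y = x" "y \<oplus> (x \<ominus> y) = x"
proof -
  show *: "(x \<ominus> y) \<oplus> y = x" by (simp add: M.minus_eq M.a_assoc M.l_neg)
  show "y \<oplus> (x \<ominus> y) = x" using * by (simp add: M.a_comm)
qed

lemma add_diff_cancel [simp]:
  assumes [simp]: "x \<in> carrier G" "y \<in> carrier G"
  shows "(x \<oplus> y) \<ominus> y = x"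
  by (simp add: M.minus_eq M.a_assoc M.r_neg)

lemma diff_le_iff:
  assumes [simp]: "x \<in> carrier G" "y \<in> carrier G" "z \<in> carrier G"
  shows "x \<ominus> y \<preceq> z \<longleftrightarrow> x \<preceq> z \<oplus> y"
  using add_le_cancel_right[of "x \<ominus> y" z y] by simp

lemma le_diff_iff:
  assumes [simp]: "x \<in> carrier G" "y \<in> carrier G" "z \<in> carrier G"
  shows "z \<preceq> x \<ominus> y \<longleftrightarrow> z \<oplus> y \<preceq> x"
  using add_le_cancel_right[of z "x \<ominus> y" y] by simp

lemma diff_pos: "\<lbrakk>y \<preceq> x; x \<in> carrier G; y \<in> carrier G\<rbrakk> \<Longrightarrow> x \<ominus> y \<in> pos G"
  by (simp add: pos_def le_diff_iff del: pos_carrier)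

lemma smult_mono:
  assumes "x \<preceq> y" "0 \<le> (r::real)" and [simp]: "x \<in> carrier G" "y \<in> carrier G"
  shows "r \<odot> x \<preceq> r \<odot> y"
proof -
  have "r \<odot> (y \<ominus> x) \<in> pos G" using assms by (simp add: diff_pos pos_smult)
  moreover have "r \<odot> y = r \<odot> (y \<ominus> x) \<oplus> r \<odot> x" by (simp flip: smult_add_right)
  ultimately show ?thesis by (simp add: le_add_pos2)
qed

lemma smult_mono_left:
  assumes "r \<le> (s::real)" "x \<in> pos G"
  shows "r \<odot> x \<preceq> s \<odot> x"
proof -
  have "s \<odot> x = (s - r) \<odot> x \<oplus> r \<odot> x" using assms by (simp flip: smult_add_left)
  with assms show ?thesis by (simp add: le_add_pos2)
qed

lemma smult_le_cancel:
  assumes "r \<odot> x \<preceq> r \<odot> y" "0 < (r::real)" and [simp]: "x \<in> carrier G" "y \<in> carrier G"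
  shows "x \<preceq> y"
  using smult_mono[OF assms(1), of "1/r"] assms(2) by (simp add: smult_smult)

lemma vmeet_smult_left:
  assumes "u \<in> pos G"
  shows "(r::real) \<odot> u \<triangle> s \<odot> u = min r s \<odot> u"
  using assms by (cases "r \<le> s") (simp_all add: smult_mono_left vmeet_absorb1 vmeet_absorb2)

text \<open>An element w is below x + z exactly when w - z is below x, so translation by z carries
  lower bounds to lower bounds in both directions.\<close>

lemma vmeet_add_right:
  assumes [simp]: "x \<in> carrier G" "y \<in> carrier G" "z \<in> carrier G"
  shows "(x \<oplus> z) \<triangle> (y \<oplus> z) = (x \<triangle> y) \<oplus> z"
  by (rule vmeet_eqI) (auto simp: add_le_cancel_right vmeet_left vmeet_right vmeet_greatest
      simp flip: diff_le_iff)

lemma vmeet_smult: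
  assumes [simp]: "x \<in> carrier G" "y \<in> carrier G" and r: "0 < (r::real)"
  shows "r \<odot> x \<triangle> r \<odot> y = r \<odot> (x \<triangle> y)"
proof (rule vmeet_eqI)
  fix w assume w [simp]: "w \<in> carrier G" and "w \<preceq> r \<odot> x" "w \<preceq> r \<odot> y"
  then have "(1/r) \<odot> w \<preceq> x" "(1/r) \<odot> w \<preceq> y"
    using r by (auto intro!: smult_le_cancel[of r "(1/r) \<odot> w"] simp: smult_smult)
  then have "(1/r) \<odot> w \<preceq> x \<triangle> y" by (simp add: vmeet_greatest)
  from smult_mono[OF this, of r] r show "w \<preceq> r \<odot> (x \<triangle> y)" by (simp add: smult_smult)
qed (use r in \<open>auto intro!: smult_mono vmeet_left vmeet_right\<close>)

lemma vjoin_smult: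
  assumes [simp]: "x \<in> carrier G" "y \<in> carrier G" and r: "0 < (r::real)"
  shows "r \<odot> x \<nabla> r \<odot> y = r \<odot> (x \<nabla> y)"
proof (rule vjoin_eqI)
  fix w assume w [simp]: "w \<in> carrier G" and "r \<odot> x \<preceq> w" "r \<odot> y \<preceq> w"
  then have "x \<preceq> (1/r) \<odot> w" "y \<preceq> (1/r) \<odot> w"
    using r by (auto intro!: smult_le_cancel[of r _ "(1/r) \<odot> w"] simp: smult_smult)
  then have "x \<nabla> y \<preceq> (1/r) \<odot> w" by (simp add: vjoin_least)
  from smult_mono[OF this, of r] r show "r \<odot> (x \<nabla> y) \<preceq> w" by (simp add: smult_smult)
qed (use r in \<open>auto intro!: smult_mono vjoin_left vjoin_right\<close>)

text \<open>The reflection sending w to \<open>(x \<oplus> y) \<ominus> w\<close> reverses the order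
  and swaps x and y, so it turns upper bounds of the pair into lower bounds.\<close>

lemma vjoin_eq_diff_vmeet:
  assumes [simp]: "x \<in> carrier G" "y \<in> carrier G"
  shows "x \<nabla> y = (x \<oplus> y) \<ominus> (x \<triangle> y)"
proof (rule vjoin_eqI)
  show "x \<preceq> x \<oplus> y \<ominus> (x \<triangle> y)"
    by (simp add: le_diff_iff add_le_cancel_left vmeet_right)
  show "y \<preceq> x \<oplus> y \<ominus> (x \<triangle> y)"
    using M.a_comm[of x y] by (simp add: le_diff_iff add_le_cancel_left vmeet_left)
next
  fix w assume w [simp]: "w \<in> carrier G" and *: "x \<preceq> w" "y \<preceq> w"
  have "x \<oplus> y \<ominus> w \<preceq> x" "x \<oplus> y \<ominus> w \<preceq> y"
    using * add_le_cancel_right[of x w y] by (simp_all add: diff_le_iff add_le_cancel_left M.a_comm[of y w])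
  then have "x \<oplus> y \<ominus> w \<preceq> x \<triangle> y"
    by (simp add: vmeet_greatest)
  then show "x \<oplus> y \<ominus> (x \<triangle> y) \<preceq> w"
    by (simp add: diff_le_iff M.a_comm)
qed auto

lemma vjoin_add_vmeet:
  "\<lbrakk>x \<in> carrier G; y \<in> carrier G\<rbrakk> \<Longrightarrow> (x \<nabla> y) \<oplus> (x \<triangle> y) = x \<oplus> y"
  by (simp add: vjoin_eq_diff_vmeet)

text \<open>The sum v + x is the meet of v and x plus their join, so a bound on both bounds v.
  Applied to y and to z this bounds their join, and the common join with x cancels.\<close>

lemma vmeet_vjoin_distrib:
  assumes [simp]: "x \<in> carrier G" "y \<in> carrier G" "z \<in> carrier G"
  shows "x \<triangle> (y \<nabla> z) = (x \<triangle> y) \<nabla> (x \<triangle> z)" (is "?l = ?r")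
proof (rule vle_antisym)
  let ?j = "x \<nabla> (y \<nabla> z)"
  have *: "v \<preceq> (?r \<oplus> ?j) \<ominus> x" if [simp]: "v \<in> carrier G" and v: "x \<triangle> v \<preceq> ?r" "v \<preceq> y \<nabla> z" for v
  proof -
    have "v \<oplus> x = (x \<triangle> v) \<oplus> (x \<nabla> v)" using vjoin_add_vmeet[of x v] by (simp add: M.a_comm)
    also have "x \<nabla> v \<preceq> ?j"
      by (rule vjoin_least) (auto intro: vjoin_left vle_trans[OF v(2) vjoin_right])
    then have "(x \<triangle> v) \<oplus> (x \<nabla> v) \<preceq> ?r \<oplus> ?j" by (rule add_mono2[OF v(1)]) auto
    finally show ?thesis by (simp add: le_diff_iff)
  qed
  have "y \<nabla> z \<preceq> (?r \<oplus> ?j) \<ominus> x"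
    by (rule vjoin_least) (auto intro!: * vjoin_left vjoin_right)
  then have "(y \<nabla> z) \<oplus> x \<preceq> ?r \<oplus> ?j" by (simp add: le_diff_iff)
  moreover have "(y \<nabla> z) \<oplus> x = ?l \<oplus> ?j"
    using vjoin_add_vmeet[of x "y \<nabla> z"] by (simp add: M.a_comm)
  ultimately show "?l \<preceq> ?r" by (simp add: add_le_cancel_right)
  show "?r \<preceq> ?l"
    by (intro vjoin_least vmeet_mono) (auto intro: vjoin_left vjoin_right)
qed auto

text \<open>Subtracting x from the meet m leaves something below both y and u, hence below 0; so m
  lies below x as well as below u.\<close>

lemma disjoint_add:
  assumes "x \<triangle> u = \<zero>" "y \<triangle> u = \<zero>" and [simp]: "x \<in> pos G" "y \<in> pos G" "u \<in> pos G"
  shows "(x \<oplus> y) \<triangle> u = \<zero>"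
proof (rule vle_antisym)
  let ?m = "(x \<oplus> y) \<triangle> u"
  have "?m \<ominus> x \<preceq> y"
    using vmeet_left[of "x \<oplus> y" u] by (simp add: diff_le_iff M.a_comm)
  moreover have "?m \<ominus> x \<preceq> u"
    using vle_trans[OF vmeet_right[of "x \<oplus> y" u] le_add_pos1[of u x]] by (simp add: diff_le_iff)
  ultimately have "?m \<ominus> x \<preceq> \<zero>"
    using vmeet_greatest[of "?m \<ominus> x" y u] assms by simp
  then have "?m \<preceq> x" by (simp add: diff_le_iff)
  then show "?m \<preceq> \<zero>"
    using vmeet_greatest[of ?m x u] assms vmeet_right[of "x \<oplus> y" u] by simp
qed (simp_all add: pos_ge_0)

lemma disjoint_mono:
  assumes "x \<triangle> u = \<zero>" "y \<preceq> x" "v \<preceq> u" and [simp]: "x \<in> pos G" "y \<in> pos G" "u \<in> pos G" "v \<in> pos G"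
  shows "y \<triangle> v = \<zero>"
  using vmeet_mono[of y x v u] assms(1-3) by (auto intro: vle_antisym simp: pos_ge_0)

text \<open>Natural multiples come from repeated addition. A real multiple lies below a natural one,
  and disjointness passes to smaller positive elements.\<close>

lemma disjoint_smult:
  assumes "x \<triangle> u = \<zero>" and [simp]: "x \<in> pos G" "u \<in> pos G" and "0 \<le> (r::real)"
  shows "r \<odot> x \<triangle> u = \<zero>"
proof -
  have "real n \<odot> x \<triangle> u = \<zero>" for n
  proof (induction n)
    case 0
    show ?case by (simp add: vmeet_absorb1 pos_ge_0)
  next
    case (Suc n)
    then show ?case using assms by (simp add: smult_add_left disjoint_add)
  qed
  moreover obtain n where "r \<le> real n" using real_arch_simple by blast
  ultimately show ?thesis using assms(2-4)
    by - (rule disjoint_mono[of "real n \<odot> x" u], auto simp: smult_mono_left)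
qed

end

section \<open>Truncations and unital components\<close>

text \<open>This is the value of \<open>UC\<close> on objects, stated for all trunc records so that
  the algebra of unital components can be studied before the functor.\<close>

definition uc_lattice :: "('a, 'm) trunc_scheme \<Rightarrow> 'a gorder" where
  "uc_lattice G = (vorder G)\<lparr>carrier := unital_components G\<rparr>"

lemma uc_lattice_simps [simp]:
  "carrier (uc_lattice G) = unital_components G"
  "le (uc_lattice G) = vle G"
  "eq (uc_lattice G) = (=)"
  by (simp_all add: uc_lattice_def vorder_def)

text \<open>The meet is defined by Hilbert choice among the greatest lower bounds, so its value is
  known once a candidate is exhibited and antisymmetry makes it unique. The locale is
  \<open>partial_order\<close> because the existence of meets, the first conclusion, is still to be
  shown for the structures concerned. Joins and bottom follow the same pattern.\<close>

lemma (in partial_order) meet_eqI: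
  assumes "i \<sqsubseteq> x" "i \<sqsubseteq> y" "\<And>z. \<lbrakk>z \<in> carrier L; z \<sqsubseteq> x; z \<sqsubseteq> y\<rbrakk> \<Longrightarrow> z \<sqsubseteq> i"
    and "x \<in> carrier L" "y \<in> carrier L" "i \<in> carrier L"
  shows "greatest L i (Lower L {x, y})" "x \<sqinter> y = i"
proof -
  show *: "greatest L i (Lower L {x, y})"
    using assms by (auto simp: greatest_def Lower_def)
  have "greatest L (x \<sqinter> y) (Lower L {x, y})"
    unfolding meet_def inf_def by (rule someI[of "\<lambda>i. greatest L i (Lower L {x, y})", OF *])
  then show "x \<sqinter> y = i" using * by (rule greatest_unique)
qed

lemma (in partial_order) join_eqI:
  assumes "x \<sqsubseteq> s" "y \<sqsubseteq> s" "\<And>z. \<lbrakk>z \<in> carrier L; x \<sqsubseteq> z; y \<sqsubseteq> z\<rbrakk> \<Longrightarrow> s \<sqsubseteq> z"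
    and "x \<in> carrier L" "y \<in> carrier L" "s \<in> carrier L"
  shows "least L s (Upper L {x, y})" "x \<squnion> y = s"
proof -
  show *: "least L s (Upper L {x, y})"
    using assms by (auto simp: least_def Upper_def)
  have "least L (x \<squnion> y) (Upper L {x, y})"
    unfolding join_def sup_def by (rule someI[of "\<lambda>s. least L s (Upper L {x, y})", OF *])
  then show "x \<squnion> y = s" using * by (rule least_unique)
qed

lemma (in partial_order) bottom_eqI:
  assumes "\<And>z. z \<in> carrier L \<Longrightarrow> b \<sqsubseteq> z" "b \<in> carrier L"
  shows "least L b (carrier L)" "\<bottom> = b"
proof -
  show *: "least L b (carrier L)"
    using assms by (auto simp: least_def)
  have "least L \<bottom> (carrier L)"
    unfolding bottom_def by (rule someI[of "\<lambda>b. least L b (carrier L)", OF *])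
  then show "\<bottom> = b" using * by (rule least_unique)
qed

context trunc
begin

section \<open>Truncation and the lattice operations\<close>

lemma tr_pos [simp, intro]: "g \<in> pos G \<Longrightarrow> truncation G g \<in> pos G"
  by (rule truncation_closed)

lemma tr_idem [simp]:
  assumes [simp]: "g \<in> pos G"
  shows "truncation G (truncation G g) = truncation G g"
  using truncation_lower[of "truncation G g" g] truncation_upper[of "truncation G g"]
  by (auto intro: vle_antisym simp: vmeet_absorb1)

text \<open>The lower truncation axiom puts k below its own truncation. Thus the truncated elements
  form a lower set of the positive cone.\<close>

lemma tr_below_tr:
  assumes "k \<preceq> truncation G h" and [simp]: "k \<in> pos G" "h \<in> pos G"
  shows "truncation G k = k"
  using truncation_lower[of k h] truncation_upper[of k] assms(1)
  by (auto intro: vle_antisym simp: vmeet_absorb1)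

text \<open>With \<open>truncation_upper\<close> and idempotence this makes
  \<open>truncation G g\<close> the largest truncated element below g, the form in which truncation
  is mostly handled from here on.\<close>

lemma tr_greatest:
  assumes "h \<preceq> g" "truncation G h = h" and [simp]: "h \<in> pos G" "g \<in> pos G"
  shows "h \<preceq> truncation G g"
  using truncation_lower[of g h] assms(1,2) by (simp add: vmeet_absorb2)

lemma tr_mono:
  assumes "h \<preceq> g" and [simp]: "h \<in> pos G" "g \<in> pos G"
  shows "truncation G h \<preceq> truncation G g"
  using assms(1) by (intro tr_greatest) (auto intro: vle_trans[OF truncation_upper])

lemma tr_vmeet:
  assumes [simp]: "g \<in> pos G" "h \<in> pos G"
  shows "truncation G (g \<triangle> h) = truncation G g \<triangle> truncation G h"
proof (rule vle_antisym)
  show "truncation G (g \<triangle> h) \<preceq> truncation G g \<triangle> truncation G h"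
    by (intro vmeet_greatest tr_mono) (auto intro: vmeet_left vmeet_right)
  have "truncation G (truncation G g \<triangle> truncation G h) = truncation G g \<triangle> truncation G h"
    by (rule tr_below_tr[of _ g]) (auto intro: vmeet_left)
  then show "truncation G g \<triangle> truncation G h \<preceq> truncation G (g \<triangle> h)"
    by (intro tr_greatest vmeet_mono) (auto intro: truncation_upper)
qed auto

lemma tr_vmeet_eq:
  assumes [simp]: "g \<in> pos G" "h \<in> pos G"
  shows "g \<triangle> truncation G h = truncation G g \<triangle> truncation G h"
proof (rule vle_antisym)
  show "g \<triangle> truncation G h \<preceq> truncation G g \<triangle> truncation G h"
    by (intro vmeet_greatest) (auto intro: truncation_lower vmeet_right)
  show "truncation G g \<triangle> truncation G h \<preceq> g \<triangle> truncation G h"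
    by (intro vmeet_mono) (auto intro: truncation_upper)
qed auto

text \<open>A meet with \<open>truncation G (g \<nabla> h)\<close> does not distinguish an element
  from its truncation, so distributivity splits the truncated join into parts below the two
  truncations.\<close>

lemma tr_vjoin:
  assumes [simp]: "g \<in> pos G" "h \<in> pos G"
  shows "truncation G (g \<nabla> h) = truncation G g \<nabla> truncation G h"
proof (rule vle_antisym)
  let ?t = "truncation G (g \<nabla> h)"
  have *: "?t \<triangle> x = truncation G x \<triangle> ?t" if "x \<in> pos G" for x
    using that tr_vmeet_eq[of x "g \<nabla> h"] by (simp only: vmeet_commute[of ?t] pos_vjoin assms pos_carrier)
  have "?t = ?t \<triangle> (g \<nabla> h)" by (simp add: vmeet_absorb1 truncation_upper)
  also have "\<dots> = (?t \<triangle> g) \<nabla> (?t \<triangle> h)" by (simp add: vmeet_vjoin_distrib)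
  also have "\<dots> = (truncation G g \<triangle> ?t) \<nabla> (truncation G h \<triangle> ?t)"
    by (simp only: * assms)
  also have "\<dots> \<preceq> truncation G g \<nabla> truncation G h"
    by (intro vjoin_least) (auto intro: vle_trans[OF vmeet_left vjoin_left] vle_trans[OF vmeet_left vjoin_right])
  finally show "?t \<preceq> truncation G g \<nabla> truncation G h" .
  show "truncation G g \<nabla> truncation G h \<preceq> ?t"
    by (intro vjoin_least tr_mono) (auto intro: vjoin_left vjoin_right)
qed auto

text \<open>Used in both directions, this says that truncation does not increase distances: a bound
  y on the difference of a and b also bounds the difference of their truncations.\<close>

lemma tr_add_le:
  assumes le: "a \<preceq> b \<oplus> y" and [simp]: "a \<in> pos G" "b \<in> pos G" "y \<in> pos G"
  shows "truncation G a \<preceq> truncation G b \<oplus> y"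
proof -
  let ?t = "truncation G a"
  \<comment> \<open>The positive part of \<open>?t \<ominus> y\<close>: it is below a truncated
    element, hence truncated, and below b, hence below the truncation of b.\<close>
  let ?m = "\<zero> \<nabla> (?t \<ominus> y)"
  have t: "?t \<preceq> b \<oplus> y" by (rule vle_trans[OF truncation_upper le]) auto
  have "?m \<preceq> ?t" by (rule vjoin_least) (auto simp: diff_le_iff le_add_pos1 pos_ge_0)
  then have "truncation G ?m = ?m" by (rule tr_below_tr) auto
  moreover have "?m \<preceq> b" using t by (intro vjoin_least) (auto simp: diff_le_iff pos_ge_0)
  ultimately have "?m \<preceq> truncation G b" by (intro tr_greatest) auto
  then have "?t \<ominus> y \<preceq> truncation G b" by - (rule vle_trans[OF vjoin_right], auto)
  then show ?thesis by (simp add: diff_le_iff)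
qed

section \<open>Unital components and their arithmetic\<close>

lemma truncated_elements_iff:
  "g \<in> truncated_elements G \<longleftrightarrow> g \<in> pos G \<and> truncation G g = g"
  by (auto simp: truncated_elements_def image_iff intro: sym)

lemma unital_components_iff:
  "u \<in> unital_components G \<longleftrightarrow> u \<in> pos G \<and> truncation G ((2::real) \<odot> u) = u"
proof
  assume u: "u \<in> unital_components G"
  then have [simp]: "u \<in> pos G" and tu: "truncation G u = u"
    by (auto simp: unital_components_def truncated_elements_iff)
  \<comment> \<open>The test element lies between u and 2u. Its excess over u is therefore at most
    u, yet disjoint from u, and must vanish.\<close>
  let ?v = "truncation G ((2::real) \<odot> u)"
  have [simp]: "?v \<in> pos G" by simp
  have "?v \<in> truncated_elements G" by (simp add: truncated_elements_iff)
  with u have "is_component G (u \<triangle> ?v) ?v"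
    unfolding unital_components_def by blast
  moreover have uv: "u \<preceq> ?v"
    using tu smult_mono_left[of 1 2 u] by (intro tr_greatest) auto
  ultimately have dis: "u \<triangle> (?v \<ominus> u) = \<zero>" by (simp add: is_component_def vmeet_absorb1)
  have "?v \<ominus> u \<preceq> u" using truncation_upper[of "2 \<odot> u"] by (simp add: diff_le_iff smult_2)
  with dis uv have "?v \<ominus> u = \<zero>" by (simp add: vmeet_absorb2)
  then have "?v = u" using diff_add_cancel(1)[of ?v u] by simp
  then show "u \<in> pos G \<and> truncation G ((2::real) \<odot> u) = u" by simp
next
  assume u: "u \<in> pos G \<and> truncation G ((2::real) \<odot> u) = u"
  then have [simp]: "u \<in> pos G" and t2u: "truncation G ((2::real) \<odot> u) = u" by auto
  have "truncation G u = u" using tr_idem[of "(2::real) \<odot> u"] t2u by simp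
  moreover have "is_component G (u \<triangle> g) g" if "g \<in> truncated_elements G" for g
  proof -
    have [simp]: "g \<in> pos G" and tg: "truncation G g = g"
      using that by (auto simp: truncated_elements_iff)
    let ?c = "u \<triangle> g"
    let ?x = "?c \<triangle> (g \<ominus> ?c)"
    have dpos [simp]: "g \<ominus> ?c \<in> pos G" by (simp add: diff_pos vmeet_right)
    have x_c: "?x \<preceq> ?c" and x_d: "?x \<preceq> g \<ominus> ?c" by (auto intro: vmeet_left vmeet_right)
    \<comment> \<open>The overlap \<open>?x\<close> of \<open>?c\<close> with its complement in g is
      infinitesimal: if n copies of it fit below \<open>?c\<close>, then n + 1 copies fit below g,
      hence are truncated, and below 2u, hence below the truncation of 2u, which is u. The
      archimedean axiom then removes it.\<close>
    have *: "real n \<odot> ?x \<preceq> ?c" for n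
    proof (induction n)
      case 0
      show ?case by (simp add: pos_ge_0)
    next
      case (Suc n)
      have expand: "real (Suc n) \<odot> ?x = real n \<odot> ?x \<oplus> ?x"
        using smult_add_left[of ?x "real n" 1] by (simp add: add.commute)
      have "real n \<odot> ?x \<oplus> ?x \<preceq> ?c \<oplus> (g \<ominus> ?c)"
        using Suc x_d by (intro add_mono2) auto
      then have le_g: "real (Suc n) \<odot> ?x \<preceq> g" by (simp add: expand del: of_nat_Suc)
      have c_u: "?c \<preceq> u" by (simp add: vmeet_left)
      have "real n \<odot> ?x \<oplus> ?x \<preceq> u \<oplus> u"
        using vle_trans[OF Suc c_u] vle_trans[OF x_c c_u] by (intro add_mono2) auto
      then have "real (Suc n) \<odot> ?x \<preceq> (2::real) \<odot> u" by (simp add: expand smult_2 del: of_nat_Suc)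
      moreover have "truncation G (real (Suc n) \<odot> ?x) = real (Suc n) \<odot> ?x"
        using le_g tg by (intro tr_below_tr[of _ g]) auto
      ultimately have "real (Suc n) \<odot> ?x \<preceq> u"
        using tr_greatest[of "real (Suc n) \<odot> ?x" "(2::real) \<odot> u"] t2u by simp
      then show ?case using le_g by (intro vmeet_greatest) auto
    qed
    have "?x = \<zero>" using * by (intro archimedean[of ?x ?c]) auto
    then show ?thesis by (simp add: is_component_def vmeet_right)
  qed
  ultimately show "u \<in> unital_components G"
    by (simp add: unital_components_def truncated_elements_iff)
qed

lemma unital_pos [simp]: "u \<in> unital_components G \<Longrightarrow> u \<in> pos G"
  by (simp add: unital_components_iff)

lemma unital_tr_2: "u \<in> unital_components G \<Longrightarrow> truncation G ((2::real) \<odot> u) = u"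
  by (simp add: unital_components_iff)

lemma unital_tr: "u \<in> unital_components G \<Longrightarrow> truncation G u = u"
  using tr_idem[of "(2::real) \<odot> u"] by (simp add: unital_tr_2)

lemma unital_disjoint:
  assumes "u \<in> unital_components G" "u \<preceq> g" "truncation G g = g" and [simp]: "g \<in> pos G"
  shows "u \<triangle> (g \<ominus> u) = \<zero>"
proof -
  have "g \<in> truncated_elements G" using assms by (simp add: truncated_elements_iff)
  with assms(1) have "is_component G (u \<triangle> g) g"
    unfolding unital_components_def by blast
  then show ?thesis using assms by (simp add: is_component_def vmeet_absorb1)
qed

lemma unital_zero [simp]: "\<zero> \<in> unital_components G"
  using truncation_upper[of \<zero>] by (auto simp: unital_components_iff pos_ge_0 intro: vle_antisym)

lemma unital_vmeet [simp, intro]: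
  assumes "u \<in> unital_components G" "v \<in> unital_components G"
  shows "u \<triangle> v \<in> unital_components G"
  using assms unital_pos[OF assms(1)] unital_pos[OF assms(2)]
  by (simp add: unital_components_iff tr_vmeet flip: vmeet_smult)

lemma unital_vjoin [simp, intro]:
  assumes "u \<in> unital_components G" "v \<in> unital_components G"
  shows "u \<nabla> v \<in> unital_components G"
  using assms unital_pos[OF assms(1)] unital_pos[OF assms(2)]
  by (simp add: unital_components_iff tr_vjoin flip: vjoin_smult)

lemma disjoint_vjoin:
  "\<lbrakk>x \<triangle> y = \<zero>; x \<in> carrier G; y \<in> carrier G\<rbrakk> \<Longrightarrow> x \<nabla> y = x \<oplus> y"
  using vjoin_add_vmeet[of x y] by simp

text \<open>The truncation w of 2(u - v) is disjoint from v and below the truncation of 2u, which is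
  u. So w + v is the join of w and v and still below u, which forces w below u - v.\<close>

lemma unital_diff:
  assumes u: "u \<in> unital_components G" and v: "v \<in> unital_components G" and "v \<preceq> u"
  shows "u \<ominus> v \<in> unital_components G"
proof -
  have [simp]: "u \<in> pos G" "v \<in> pos G" using u v by auto
  let ?c = "u \<ominus> v"
  have c [simp]: "?c \<in> pos G" using assms by (simp add: diff_pos)
  have dis: "v \<triangle> ?c = \<zero>" using assms by (intro unital_disjoint) (auto simp: unital_tr)
  have cu: "?c \<preceq> u" by (simp add: diff_le_iff le_add_pos1)
  let ?w = "truncation G ((2::real) \<odot> ?c)"
  have "?c \<triangle> v = \<zero>" using dis by (simp add: vmeet_commute)
  then have "(2::real) \<odot> ?c \<triangle> v = \<zero>" by (simp add: disjoint_smult)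
  then have "?w \<triangle> v = \<zero>"
    by (rule disjoint_mono) (auto intro: truncation_upper)
  then have "?w \<nabla> v = ?w \<oplus> v" by (simp add: disjoint_vjoin)
  moreover have "?w \<preceq> u"
    using tr_mono[OF smult_mono[OF cu, of 2]] unital_tr_2[OF u] by simp
  then have "?w \<nabla> v \<preceq> u" using assms by (intro vjoin_least) auto
  ultimately have "?w \<preceq> ?c" by (simp add: le_diff_iff)
  moreover have "?c \<preceq> ?w"
  proof (rule tr_greatest)
    show "truncation G ?c = ?c" using cu unital_tr[OF u] by (intro tr_below_tr[of _ u]) auto
  qed (use smult_mono_left[of 1 2 ?c] in auto)
  ultimately have "?w = ?c" by (intro vle_antisym) auto
  then show ?thesis by (simp add: unital_components_iff)
qed

text \<open>For r > 1 the excess of the truncation over u is disjoint from u, and so from (r - 1)u,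
  while being bounded by (r - 1)u; hence it vanishes. For r \<le> 1 the multiple lies below u, which
  is truncated.\<close>

lemma tr_smult_unital:
  assumes u: "u \<in> unital_components G" and r: "0 \<le> (r::real)"
  shows "truncation G (r \<odot> u) = min r 1 \<odot> u"
proof (cases "r \<le> 1")
  case True
  then show ?thesis
    using u r smult_mono_left[of r 1 u] unital_tr[OF u] by (simp add: tr_below_tr[of _ u])
next
  case False
  let ?t = "truncation G (r \<odot> u)"
  have [simp]: "u \<in> pos G" "?t \<in> pos G" using u r by auto
  have ut: "u \<preceq> ?t"
    using False smult_mono_left[of 1 r u] unital_tr[OF u] r by (intro tr_greatest) auto
  have dis: "u \<triangle> (?t \<ominus> u) = \<zero>"
    using u ut r by (intro unital_disjoint) auto
  have [simp]: "?t \<ominus> u \<in> pos G" using ut by (simp add: diff_pos)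
  have "(r - 1) \<odot> u \<triangle> (?t \<ominus> u) = \<zero>" using dis False by (simp add: disjoint_smult)
  moreover have eq: "r \<odot> u = (r - 1) \<odot> u \<oplus> u" using smult_add_left[of u "r - 1" 1] by simp
  have t: "?t \<preceq> r \<odot> u" using r by (simp add: truncation_upper)
  have "?t \<preceq> (r - 1) \<odot> u \<oplus> u" by (simp only: t flip: eq)
  then have "?t \<ominus> u \<preceq> (r - 1) \<odot> u" using diff_le_iff[of ?t u "(r - 1) \<odot> u"] by simp
  ultimately have "?t \<ominus> u = \<zero>" by (simp add: vmeet_absorb2)
  then have "?t = u" using diff_add_cancel(1)[of ?t u] by simp
  with False show ?thesis by simp
qed

section \<open>The generalized Boolean algebra of unital components\<close>

lemma uc_lattice_partial_order: "partial_order (uc_lattice G)"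
  by unfold_locales (auto intro: vle_antisym vle_trans)

lemma uc_lattice_meet:
  assumes "u \<in> unital_components G" "v \<in> unital_components G"
  shows "greatest (uc_lattice G) (u \<triangle> v) (Lower (uc_lattice G) {u, v})"
    and "u \<sqinter>\<^bsub>uc_lattice G\<^esub> v = u \<triangle> v"
  using assms partial_order.meet_eqI[OF uc_lattice_partial_order, of "u \<triangle> v" u v]
  by (simp_all add: vmeet_left vmeet_right vmeet_greatest)

lemma uc_lattice_join:
  assumes "u \<in> unital_components G" "v \<in> unital_components G"
  shows "least (uc_lattice G) (u \<nabla> v) (Upper (uc_lattice G) {u, v})"
    and "u \<squnion>\<^bsub>uc_lattice G\<^esub> v = u \<nabla> v"
  using assms partial_order.join_eqI[OF uc_lattice_partial_order, of u "u \<nabla> v" v]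
  by (simp_all add: vjoin_left vjoin_right vjoin_least)

lemma uc_lattice_bottom:
  shows "least (uc_lattice G) \<zero> (carrier (uc_lattice G))" and "\<bottom>\<^bsub>uc_lattice G\<^esub> = \<zero>"
  using partial_order.bottom_eqI[OF uc_lattice_partial_order, of \<zero>]
  by (simp_all add: pos_ge_0)

text \<open>The witness is u minus its meet with v. The last clause serves the primes: if u belongs
  to a prime and the meet does not, then c does.\<close>

lemma unital_relative_complement:
  assumes u: "u \<in> unital_components G" and v: "v \<in> unital_components G"
  obtains c where "c \<in> unital_components G" "c \<nabla> v = u \<nabla> v" "c \<triangle> v = \<zero>"
    "u = (u \<triangle> v) \<nabla> c"
proof
  have [simp]: "u \<in> pos G" "v \<in> pos G" using u v by auto
  let ?m = "u \<triangle> v"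
  let ?c = "u \<ominus> ?m"
  show c [simp]: "?c \<in> unital_components G" using u v by (simp add: unital_diff vmeet_left)
  have dis: "?m \<triangle> ?c = \<zero>"
    using u v by (intro unital_disjoint) (auto simp: unital_tr vmeet_left)
  have "?c \<triangle> u = ?c" by (rule vmeet_absorb1) (auto simp: diff_le_iff le_add_pos1)
  then have "?c \<triangle> v = ?c \<triangle> u \<triangle> v" by simp
  also have "\<dots> = ?c \<triangle> ?m" using c by (simp add: vmeet_assoc del: c)
  also have "\<dots> = \<zero>" using dis by (simp add: vmeet_commute)
  finally show cv: "?c \<triangle> v = \<zero>" .
  \<comment> \<open>The two sides of the identity for the join are compared after adding the meet,
    where the sum rule for meets and joins applies.\<close>
  have "?m \<oplus> (?c \<oplus> v) = (?m \<oplus> ?c) \<oplus> v" by (rule M.a_assoc[symmetric]) auto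
  also have "\<dots> = (u \<nabla> v) \<oplus> ?m" by (simp add: vjoin_add_vmeet)
  also have "\<dots> = ?m \<oplus> (u \<nabla> v)" by (rule M.a_comm) auto
  finally have "u \<nabla> v = ?c \<oplus> v" by simp
  then show "?c \<nabla> v = u \<nabla> v" using cv by (simp add: disjoint_vjoin)
  show "u = ?m \<nabla> ?c" using dis by (simp add: disjoint_vjoin)
qed

lemma uc_lattice_gba: "generalized_boolean_algebra (uc_lattice G)"
proof -
  interpret po: partial_order "uc_lattice G" by (rule uc_lattice_partial_order)
  show ?thesis
  proof unfold_locales
    show "\<exists>s. least (uc_lattice G) s (Upper (uc_lattice G) {x, y})"
      if "x \<in> carrier (uc_lattice G)" "y \<in> carrier (uc_lattice G)" for x y
      using that uc_lattice_join(1) by auto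
    show "\<exists>s. greatest (uc_lattice G) s (Lower (uc_lattice G) {x, y})"
      if "x \<in> carrier (uc_lattice G)" "y \<in> carrier (uc_lattice G)" for x y
      using that uc_lattice_meet(1) by auto
    show "\<exists>x. least (uc_lattice G) x (carrier (uc_lattice G))"
      using uc_lattice_bottom(1) by blast
  qed (auto simp: uc_lattice_meet uc_lattice_join uc_lattice_bottom vmeet_vjoin_distrib
      elim: unital_relative_complement)
qed

end

section \<open>Evaluation at prime filters\<close>

text \<open>
  The empty set counts as a prime: the elements of \<open>primes L\<close> correspond to all bottom-preserving
  lattice homomorphisms from \<open>L\<close> to the two-element chain, including the zero homomorphism.
  This makes \<open>primes\<close> functorial.
\<close>

definition primes :: "('a, 'm) gorder_scheme \<Rightarrow> 'a set set" where
  "primes L = {p. p \<subseteq> carrier L \<and> \<bottom>\<^bsub>L\<^esub> \<notin> p \<and>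
     (\<forall>a\<in>carrier L. \<forall>b\<in>carrier L. a \<sqinter>\<^bsub>L\<^esub> b \<in> p \<longleftrightarrow> a \<in> p \<and> b \<in> p) \<and>
     (\<forall>a\<in>carrier L. \<forall>b\<in>carrier L. a \<squnion>\<^bsub>L\<^esub> b \<in> p \<longleftrightarrow> a \<in> p \<or> b \<in> p)}"

section \<open>The prime ideal theorem\<close>

context generalized_boolean_algebra
begin

text \<open>Zorn's lemma is applied to the ideals that contain K and miss u; the complement of a
  maximal one is the required prime. Since there need not be a top, properness of an ideal is
  replaced by missing the fixed element u.\<close>

lemma prime_separation:
  assumes K: "K \<subseteq> carrier L" "\<bottom> \<in> K"
    and down: "\<And>a b. \<lbrakk>a \<in> carrier L; b \<in> K; a \<sqsubseteq> b\<rbrakk> \<Longrightarrow> a \<in> K"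
    and join: "\<And>a b. \<lbrakk>a \<in> K; b \<in> K\<rbrakk> \<Longrightarrow> a \<squnion> b \<in> K"
    and u: "u \<in> carrier L" "u \<notin> K"
  obtains p where "p \<in> primes L" "u \<in> p" "p \<inter> K = {}"
proof -
  define ideals where "ideals = {I. K \<subseteq> I \<and> I \<subseteq> carrier L \<and> u \<notin> I \<and>
    (\<forall>a\<in>carrier L. \<forall>b\<in>I. a \<sqsubseteq> b \<longrightarrow> a \<in> I) \<and> (\<forall>a\<in>I. \<forall>b\<in>I. a \<squnion> b \<in> I)}"
  have "K \<in> ideals" using K down join u unfolding ideals_def by blast
  moreover have "\<Union>\<C> \<in> ideals" if "\<C> \<noteq> {}" and C: "subset.chain ideals \<C>" for \<C>
  proof -
    have "\<C> \<subseteq> ideals" and chain: "\<And>I J. \<lbrakk>I \<in> \<C>; J \<in> \<C>\<rbrakk> \<Longrightarrow> I \<subseteq> J \<or> J \<subseteq> I"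
      using C unfolding subset_chain_def by blast+
    moreover have "a \<squnion> b \<in> \<Union>\<C>" if ab: "a \<in> I" "I \<in> \<C>" "b \<in> J" "J \<in> \<C>" for a b I J
    proof -
      have "a \<in> I \<union> J" "b \<in> I \<union> J" "I \<union> J \<in> \<C>"
        using ab chain[of I J] by (auto simp: Un_absorb1 Un_absorb2)
      then show ?thesis using \<open>\<C> \<subseteq> ideals\<close> unfolding ideals_def by blast
    qed
    moreover have "a \<in> \<Union>\<C>" if "a \<in> carrier L" "b \<in> I" "I \<in> \<C>" "a \<sqsubseteq> b" for a b I
      using that \<open>\<C> \<subseteq> ideals\<close> unfolding ideals_def by blast
    moreover have "K \<subseteq> \<Union>\<C>" "\<Union>\<C> \<subseteq> carrier L" "u \<notin> \<Union>\<C>"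
      using \<open>\<C> \<noteq> {}\<close> \<open>\<C> \<subseteq> ideals\<close> unfolding ideals_def by blast+
    ultimately show ?thesis unfolding ideals_def by blast
  qed
  ultimately obtain M where "M \<in> ideals" and max: "\<And>J. \<lbrakk>J \<in> ideals; M \<subseteq> J\<rbrakk> \<Longrightarrow> J = M"
    using subset_Zorn_nonempty[of ideals] by blast
  then have KM: "K \<subseteq> M" and M_carrier: "M \<subseteq> carrier L" and uM: "u \<notin> M"
    and downM: "\<And>a b. \<lbrakk>a \<in> carrier L; b \<in> M; a \<sqsubseteq> b\<rbrakk> \<Longrightarrow> a \<in> M"
    and joinM: "\<And>a b. \<lbrakk>a \<in> M; b \<in> M\<rbrakk> \<Longrightarrow> a \<squnion> b \<in> M"
    unfolding ideals_def by blast+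
  have ext: "\<exists>m\<in>M. u \<sqsubseteq> m \<squnion> a" if a: "a \<in> carrier L" "a \<notin> M" for a
  proof (rule ccontr)
    assume *: "\<not> ?thesis"
    \<comment> \<open>The ideal generated by M and a. If it missed u, it would contradict
      maximality.\<close>
    define J where "J = {b \<in> carrier L. \<exists>m\<in>M. b \<sqsubseteq> m \<squnion> a}"
    have MJ: "M \<subseteq> J" using M_carrier a by (auto simp: J_def subset_iff intro!: bexI join_left)
    have "a \<in> J" using a K KM M_carrier by (auto simp: J_def subset_iff intro!: bexI[of _ \<bottom>] join_right)
    moreover have "J \<in> ideals"
    proof -
      have "b \<squnion> c \<in> J" if bc: "b \<in> J" "c \<in> J" for b c
      proof -
        from bc obtain m n where mn: "m \<in> M" "n \<in> M" "b \<sqsubseteq> m \<squnion> a" "c \<sqsubseteq> n \<squnion> a"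
          and [simp]: "b \<in> carrier L" "c \<in> carrier L" by (auto simp: J_def)
        have [simp]: "m \<in> carrier L" "n \<in> carrier L" using mn M_carrier by auto
        have "m \<squnion> a \<sqsubseteq> (m \<squnion> n) \<squnion> a" "n \<squnion> a \<sqsubseteq> (m \<squnion> n) \<squnion> a"
          using a by (auto intro!: join_le intro: le_trans[OF join_left join_left]
              le_trans[OF join_right join_left] join_right)
        then have "b \<squnion> c \<sqsubseteq> (m \<squnion> n) \<squnion> a"
          using mn a by (intro join_le) (auto intro: le_trans[of b "m \<squnion> a"] le_trans[of c "n \<squnion> a"])
        then show ?thesis using joinM mn by (auto simp: J_def)
      qed
      moreover have "b \<in> J" if "b \<in> carrier L" "c \<in> J" "b \<sqsubseteq> c" for b c
      proof -
        from that obtain m where "m \<in> M" "c \<sqsubseteq> m \<squnion> a" "c \<in> carrier L" by (auto simp: J_def)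
        then have "b \<sqsubseteq> m \<squnion> a" using that a M_carrier by (blast intro: le_trans join_closed)
        then show ?thesis using that \<open>m \<in> M\<close> by (auto simp: J_def)
      qed
      moreover have "u \<notin> J" using * by (auto simp: J_def)
      moreover have "J \<subseteq> carrier L" by (auto simp: J_def)
      ultimately show ?thesis using KM MJ unfolding ideals_def by blast
    qed
    ultimately show False using max MJ a by blast
  qed
  have prime: "a \<in> M \<or> b \<in> M" if ab: "a \<in> carrier L" "b \<in> carrier L" "a \<sqinter> b \<in> M" for a b
  proof (rule ccontr)
    assume "\<not> ?thesis"
    then obtain m n where mn: "m \<in> M" "n \<in> M" "u \<sqsubseteq> m \<squnion> a" "u \<sqsubseteq> n \<squnion> b"
      using ext[OF ab(1)] ext[OF ab(2)] by metis
    then have [simp]: "m \<in> carrier L" "n \<in> carrier L" using M_carrier by auto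
    \<comment> \<open>A single member of M for both bounds on u, so that the two expansions by
      distributivity fit together.\<close>
    define k where "k = m \<squnion> n"
    have k [simp]: "k \<in> carrier L" "k \<in> M" using joinM mn by (auto simp: k_def)
    have "m \<squnion> a \<sqsubseteq> k \<squnion> a" "n \<squnion> b \<sqsubseteq> k \<squnion> b"
      using ab unfolding k_def by (auto intro!: join_le intro: le_trans[OF join_left join_left]
              le_trans[OF join_right join_left] join_right)
    then have uka: "u \<sqsubseteq> k \<squnion> a" and ukb: "u \<sqsubseteq> k \<squnion> b"
      using mn ab u le_trans[of u "m \<squnion> a" "k \<squnion> a"] le_trans[of u "n \<squnion> b" "k \<squnion> b"] by auto
    have "u = u \<sqinter> (k \<squnion> a)" using uka u ab by (simp add: le_iff_join[symmetric])
    also have "\<dots> = (u \<sqinter> k) \<squnion> (u \<sqinter> a)" using u ab by (simp add: distrib)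
    finally have 1: "u = (u \<sqinter> k) \<squnion> (u \<sqinter> a)" .
    have "u \<sqinter> k \<in> M" using u downM[of "u \<sqinter> k" k] by (simp add: meet_right)
    \<comment> \<open>The second bound expands this into a part below k and a part below
      \<open>a \<sqinter> b\<close>, both in the ideal.\<close>
    moreover have "u \<sqinter> a \<in> M"
    proof -
      have "u \<sqinter> a = (u \<sqinter> a) \<sqinter> (k \<squnion> b)"
        using u ab ukb by (intro le_iff_join[THEN iffD1]) (auto intro: le_trans[OF meet_left])
      also have "\<dots> = ((u \<sqinter> a) \<sqinter> k) \<squnion> ((u \<sqinter> a) \<sqinter> b)" using u ab by (simp add: distrib)
      also have "\<dots> \<in> M"
      proof (rule joinM)
        show "(u \<sqinter> a) \<sqinter> k \<in> M" using u ab downM[of _ k] by (simp add: meet_right)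
        have "(u \<sqinter> a) \<sqinter> b \<sqsubseteq> a \<sqinter> b"
          using u ab by (intro meet_le) (auto intro: le_trans[OF meet_left meet_right] meet_right)
        then show "(u \<sqinter> a) \<sqinter> b \<in> M" using u ab downM[of _ "a \<sqinter> b"] by simp
      qed
      finally show ?thesis .
    qed
    ultimately have "u \<in> M" using 1 joinM by metis
    then show False using uM by simp
  qed
  show ?thesis
  proof
    have "a \<sqinter> b \<in> M \<longleftrightarrow> a \<in> M \<or> b \<in> M" if "a \<in> carrier L" "b \<in> carrier L" for a b
      using prime[OF that] downM[OF meet_closed[OF that] _ meet_left[OF that]]
        downM[OF meet_closed[OF that] _ meet_right[OF that]] by blast
    moreover have "a \<squnion> b \<in> M \<longleftrightarrow> a \<in> M \<and> b \<in> M" if "a \<in> carrier L" "b \<in> carrier L" for a b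
      using joinM[of a b] downM[OF that(1) _ join_left[OF that]]
        downM[OF that(2) _ join_right[OF that]] by blast
    ultimately show "carrier L - M \<in> primes L"
      using K KM by (auto simp: primes_def)
    show "u \<in> carrier L - M" "(carrier L - M) \<inter> K = {}" using u uM KM by auto
  qed
qed

end

text \<open>The two inequalities say that y bounds the absolute value of g - r u. Asking for a bound
  of the error, not for its exact value, makes the relation stable under lattice operations and
  truncation. The first disjunct assigns 0 at the empty prime, which offers no u.\<close>

definition agrees :: "('a, 'm) vlat_scheme \<Rightarrow> 'a set \<Rightarrow> 'a \<Rightarrow> real \<Rightarrow> bool" where
  "agrees G p g r \<longleftrightarrow> p = {} \<and> r = 0 \<or>
     (\<exists>u\<in>p. \<exists>y\<in>pos G. y \<triangle>\<^bsub>G\<^esub> u = \<zero>\<^bsub>G\<^esub> \<and>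
       g \<preceq>\<^bsub>G\<^esub> r \<odot>\<^bsub>G\<^esub> u \<oplus>\<^bsub>G\<^esub> y \<and> r \<odot>\<^bsub>G\<^esub> u \<preceq>\<^bsub>G\<^esub> g \<oplus>\<^bsub>G\<^esub> y)"

definition evaluation :: "('a, 'm) vlat_scheme \<Rightarrow> 'a set \<Rightarrow> 'a \<Rightarrow> real" where
  "evaluation G p g = (THE r. agrees G p g r)"

section \<open>Agreement of elements with real numbers at a prime\<close>

locale trunc_prime = trunc +
  fixes p
  assumes prime: "p \<in> primes (uc_lattice G)"
begin

lemma prime_unital [simp]: "u \<in> p \<Longrightarrow> u \<in> unital_components G"
  using prime by (auto simp: primes_def)

lemma prime_zero: "\<zero> \<notin> p"
  using prime by (auto simp: primes_def uc_lattice_bottom)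

lemma prime_vmeet:
  "\<lbrakk>u \<in> unital_components G; v \<in> unital_components G\<rbrakk> \<Longrightarrow> u \<triangle> v \<in> p \<longleftrightarrow> u \<in> p \<and> v \<in> p"
  using prime by (auto simp: primes_def uc_lattice_meet)

lemma prime_vjoin:
  "\<lbrakk>u \<in> unital_components G; v \<in> unital_components G\<rbrakk> \<Longrightarrow> u \<nabla> v \<in> p \<longleftrightarrow> u \<in> p \<or> v \<in> p"
  using prime by (auto simp: primes_def uc_lattice_join)

lemma agreesI:
  "\<lbrakk>u \<in> p; y \<in> pos G; y \<triangle> u = \<zero>; g \<preceq> r \<odot> u \<oplus> y; r \<odot> u \<preceq> g \<oplus> y\<rbrakk> \<Longrightarrow> agrees G p g r"
  unfolding agrees_def by blast

text \<open>Over the smaller w, the term r u splits into r w and r(u - w). The second part is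
  disjoint from w and is absorbed into the error.\<close>

lemma agrees_shrink:
  assumes g [simp]: "g \<in> carrier G"
    and u: "u \<in> unital_components G" and w: "w \<in> unital_components G" and wu: "w \<preceq> u"
    and y: "y \<in> pos G" "y \<triangle> u = \<zero>" and le: "g \<preceq> r \<odot> u \<oplus> y" "(r::real) \<odot> u \<preceq> g \<oplus> y"
  obtains y' where "y' \<in> pos G" "y' \<triangle> w = \<zero>" "g \<preceq> r \<odot> w \<oplus> y'" "r \<odot> w \<preceq> g \<oplus> y'"
proof
  have [simp]: "u \<in> pos G" "w \<in> pos G" "y \<in> pos G" using u w y by auto
  let ?d = "u \<ominus> w"
  \<comment> \<open>The absolute value makes this serve both inequalities, whatever the sign of
    r.\<close>
  let ?e = "\<bar>r\<bar> \<odot> ?d"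
  have [simp]: "?d \<in> pos G" using wu by (simp add: diff_pos)
  show "?e \<oplus> y \<in> pos G" by simp
  have "?d \<triangle> w = \<zero>"
    using unital_disjoint[of w u] u w wu by (simp add: unital_tr vmeet_commute)
  then show "(?e \<oplus> y) \<triangle> w = \<zero>"
    using y wu by (intro disjoint_add disjoint_smult) (auto intro: disjoint_mono[of y u])
  have ru: "r \<odot> u = r \<odot> w \<oplus> r \<odot> ?d" by (simp flip: smult_add_right)
  have "r \<odot> w \<oplus> r \<odot> ?d \<preceq> r \<odot> w \<oplus> ?e"
    by (simp add: add_le_cancel_left smult_mono_left)
  then have "r \<odot> w \<oplus> r \<odot> ?d \<oplus> y \<preceq> r \<odot> w \<oplus> ?e \<oplus> y"
    by (simp add: add_le_cancel_right)
  then have "g \<preceq> r \<odot> w \<oplus> ?e \<oplus> y"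
    using le(1) ru by (auto intro: vle_trans)
  then show "g \<preceq> r \<odot> w \<oplus> (?e \<oplus> y)" by (simp add: M.a_assoc)
  have "\<zero> \<preceq> (r + \<bar>r\<bar>) \<odot> ?d" by (intro pos_ge_0 pos_smult) auto
  then have "\<zero> \<preceq> r \<odot> ?d \<oplus> ?e" by (simp add: smult_add_left)
  then have "r \<odot> w \<preceq> r \<odot> w \<oplus> (r \<odot> ?d \<oplus> ?e)"
    by (intro le_add_pos1) (auto intro: pos_upward[OF zero_pos])
  also have "\<dots> = r \<odot> u \<oplus> ?e" by (simp add: ru M.a_assoc)
  also have "\<dots> \<preceq> g \<oplus> y \<oplus> ?e" using le(2) by (simp add: add_le_cancel_right)
  also have "\<dots> = g \<oplus> (?e \<oplus> y)" by (simp add: M.a_ac)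
  finally show "r \<odot> w \<preceq> g \<oplus> (?e \<oplus> y)" by simp
qed

text \<open>Primes are closed under meets, so both approximations can be shrunk to the meet of their
  components and the errors added. Called with the same agreement twice, it merely unpacks
  \<open>agrees\<close> at a nonempty prime.\<close>

lemma agrees_common:
  assumes "agrees G p g r" "agrees G p h s" "p \<noteq> {}" and [simp]: "g \<in> carrier G" "h \<in> carrier G"
  obtains u y where "u \<in> p" "y \<in> pos G" "y \<triangle> u = \<zero>"
    "g \<preceq> r \<odot> u \<oplus> y" "r \<odot> u \<preceq> g \<oplus> y" "h \<preceq> s \<odot> u \<oplus> y" "s \<odot> u \<preceq> h \<oplus> y"
proof -
  obtain u y where u: "u \<in> p" "y \<in> pos G" "y \<triangle> u = \<zero>" "g \<preceq> r \<odot> u \<oplus> y" "r \<odot> u \<preceq> g \<oplus> y"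
    using assms unfolding agrees_def by blast
  obtain v z where v: "v \<in> p" "z \<in> pos G" "z \<triangle> v = \<zero>" "h \<preceq> s \<odot> v \<oplus> z" "s \<odot> v \<preceq> h \<oplus> z"
    using assms unfolding agrees_def by blast
  let ?w = "u \<triangle> v"
  have w: "?w \<in> p" using u v by (simp add: prime_vmeet)
  have [simp]: "u \<in> pos G" "v \<in> pos G" using u v by auto
  obtain y' where y': "y' \<in> pos G" "y' \<triangle> ?w = \<zero>" "g \<preceq> r \<odot> ?w \<oplus> y'" "r \<odot> ?w \<preceq> g \<oplus> y'"
    by (rule agrees_shrink[of g u ?w y r]) (use u w in \<open>auto intro: vmeet_left\<close>)
  obtain z' where z': "z' \<in> pos G" "z' \<triangle> ?w = \<zero>" "h \<preceq> s \<odot> ?w \<oplus> z'" "s \<odot> ?w \<preceq> h \<oplus> z'"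
    by (rule agrees_shrink[of h v ?w z s]) (use v w in \<open>auto intro: vmeet_right\<close>)
  have enlarge: "a \<preceq> b \<oplus> (y' \<oplus> z')" if "a \<preceq> b \<oplus> y' \<or> a \<preceq> b \<oplus> z'" and [simp]: "a \<in> carrier G" "b \<in> carrier G" for a b
  proof -
    have "b \<oplus> y' \<preceq> b \<oplus> (y' \<oplus> z')" "b \<oplus> z' \<preceq> b \<oplus> (y' \<oplus> z')"
      using y' z' by (simp_all add: add_le_cancel_left le_add_pos1 le_add_pos2)
    then show ?thesis using that(1) y'(1) z'(1) by (auto intro: vle_trans)
  qed
  show ?thesis
  proof (rule that[of ?w "y' \<oplus> z'"])
    show "(y' \<oplus> z') \<triangle> ?w = \<zero>" using y' z' by (intro disjoint_add) auto
  qed (use w y' z' in \<open>auto intro: enlarge\<close>)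
qed

text \<open>If r < s, then (s - r)u would be bounded by 2y, which is disjoint from u. A positive
  multiple of u would thus be disjoint from u, forcing u to be zero, and no prime contains
  zero.\<close>

lemma agrees_unique_aux:
  assumes "agrees G p g r" "agrees G p g s" "p \<noteq> {}" and [simp]: "g \<in> carrier G"
  shows "s \<le> r"
proof (rule ccontr)
  assume "\<not> s \<le> r"
  then have rs: "r < s" by simp
  obtain u y where u: "u \<in> p" "y \<in> pos G" "y \<triangle> u = \<zero>" "g \<preceq> r \<odot> u \<oplus> y" "s \<odot> u \<preceq> g \<oplus> y"
    by (rule agrees_common[OF assms(1,2,3)]) auto
  have [simp]: "u \<in> pos G" "y \<in> pos G" using u by auto
  have "g \<oplus> y \<preceq> r \<odot> u \<oplus> y \<oplus> y" using u(4) by (simp add: add_le_cancel_right)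
  with u(5) have "s \<odot> u \<preceq> r \<odot> u \<oplus> y \<oplus> y" by (auto intro: vle_trans)
  then have "r \<odot> u \<oplus> (s - r) \<odot> u \<preceq> r \<odot> u \<oplus> (y \<oplus> y)"
    by (simp add: M.a_assoc flip: smult_add_left)
  then have *: "(s - r) \<odot> u \<preceq> y \<oplus> y" by (simp add: add_le_cancel_left)
  have "(y \<oplus> y) \<triangle> u = \<zero>" using u by (intro disjoint_add) auto
  then have "(s - r) \<odot> u \<triangle> u = \<zero>"
    by (rule disjoint_mono) (use * rs in auto)
  then have "min (s - r) 1 \<odot> u = \<zero>" using vmeet_smult_left[of u "s - r" 1] by simp
  moreover have "(1 / min (s - r) 1) \<odot> (min (s - r) 1 \<odot> u) = u"
    using rs by (subst smult_smult) (auto simp: min_def)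
  ultimately have "u = \<zero>" by simp
  then show False using u prime_zero by simp
qed

lemma agrees_unique:
  assumes "agrees G p g r" "agrees G p g s" "g \<in> carrier G"
  shows "r = s"
  using assms agrees_unique_aux[of g r s] agrees_unique_aux[of g s r]
  by (cases "p = {}") (auto simp: agrees_def)

text \<open>For u in the prime, u witnesses the value 1 without error. Otherwise the complement c of
  u in some member v belongs to the prime, and u itself, being disjoint from c, is the error for the
  value 0.\<close>

lemma agrees_unital:
  assumes u: "u \<in> unital_components G"
  shows "agrees G p u (if u \<in> p then 1 else 0)"
proof (cases "p = {} \<or> u \<in> p")
  case True
  have [simp]: "u \<in> pos G" using u by simp
  from True show ?thesis
    using agreesI[of u \<zero> u 1] by (auto simp: agrees_def vmeet_absorb1 pos_ge_0)
next
  case False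
  then obtain v where v: "v \<in> p" by blast
  obtain c where c: "c \<in> unital_components G" "c \<triangle> u = \<zero>" "v = (v \<triangle> u) \<nabla> c"
    using unital_relative_complement[of v u] u v by (metis prime_unital)
  then have "c \<in> p"
    using prime_vjoin[of "v \<triangle> u" c] prime_vmeet[of v u] u v False by auto
  have [simp]: "u \<in> pos G" "c \<in> pos G" using u c by auto
  show ?thesis using \<open>c \<in> p\<close> c False
    by (auto intro!: agreesI[of c u] simp: vmeet_commute[of u] pos_ge_0)
qed

lemma agrees_add:
  assumes a: "agrees G p g r" "agrees G p h s" and [simp]: "g \<in> carrier G" "h \<in> carrier G"
  shows "agrees G p (g \<oplus> h) (r + s)"
proof (cases "p = {}")
  case False
  obtain u y where u: "u \<in> p" "y \<in> pos G" "y \<triangle> u = \<zero>" "g \<preceq> r \<odot> u \<oplus> y" "r \<odot> u \<preceq> g \<oplus> y"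
    "h \<preceq> s \<odot> u \<oplus> y" "s \<odot> u \<preceq> h \<oplus> y" by (rule agrees_common[OF a False]) auto
  have [simp]: "u \<in> pos G" "y \<in> pos G" using u by auto
  have "g \<oplus> h \<preceq> (r \<odot> u \<oplus> y) \<oplus> (s \<odot> u \<oplus> y)" using u by (intro add_mono2) auto
  also have "\<dots> = (r + s) \<odot> u \<oplus> (y \<oplus> y)" by (simp add: smult_add_left M.a_ac)
  finally have 1: "g \<oplus> h \<preceq> (r + s) \<odot> u \<oplus> (y \<oplus> y)" .
  have "r \<odot> u \<oplus> s \<odot> u \<preceq> (g \<oplus> y) \<oplus> (h \<oplus> y)" using u by (intro add_mono2) auto
  also have "\<dots> = (g \<oplus> h) \<oplus> (y \<oplus> y)" by (simp add: M.a_ac)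
  finally have "(r + s) \<odot> u \<preceq> (g \<oplus> h) \<oplus> (y \<oplus> y)" by (simp add: smult_add_left)
  with 1 show ?thesis using u by (intro agreesI[of u "y \<oplus> y"]) (auto intro: disjoint_add)
qed (use a in \<open>simp add: agrees_def\<close>)

lemma agrees_smult_nonneg:
  assumes a: "agrees G p g r" and c: "0 \<le> c" and [simp]: "g \<in> carrier G"
  shows "agrees G p (c \<odot> g) (c * r)"
proof (cases "p = {}")
  case False
  obtain u y where u: "u \<in> p" "y \<in> pos G" "y \<triangle> u = \<zero>" "g \<preceq> r \<odot> u \<oplus> y" "r \<odot> u \<preceq> g \<oplus> y"
    by (rule agrees_common[OF a a False]) auto
  have [simp]: "u \<in> pos G" "y \<in> pos G" using u by auto
  have "c \<odot> g \<preceq> c \<odot> (r \<odot> u \<oplus> y)" "c \<odot> (r \<odot> u) \<preceq> c \<odot> (g \<oplus> y)"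
    using u c by (auto intro: smult_mono)
  then show ?thesis using u c
    by (intro agreesI[of u "c \<odot> y"]) (auto simp: smult_smult smult_add_right disjoint_smult)
qed (use a in \<open>simp add: agrees_def\<close>)

lemma agrees_minus:
  assumes a: "agrees G p g r" and [simp]: "g \<in> carrier G"
  shows "agrees G p (\<ominus> g) (- r)"
proof (cases "p = {}")
  case False
  obtain u y where u: "u \<in> p" "y \<in> pos G" "y \<triangle> u = \<zero>" "g \<preceq> r \<odot> u \<oplus> y" "r \<odot> u \<preceq> g \<oplus> y"
    by (rule agrees_common[OF a a False]) auto
  have [simp]: "u \<in> pos G" "y \<in> pos G" using u by auto
  \<comment> \<open>Negation exchanges the two inequalities that make up agreement.\<close>
  have neg: "\<ominus> b \<preceq> \<ominus> c \<oplus> y" if "c \<preceq> b \<oplus> y" and [simp]: "b \<in> carrier G" "c \<in> carrier G" for b c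
  proof -
    have "c \<oplus> (\<ominus> b \<oplus> \<ominus> c) \<preceq> (b \<oplus> y) \<oplus> (\<ominus> b \<oplus> \<ominus> c)"
      using that(1) by (simp add: add_le_cancel_right)
    moreover have "c \<oplus> (\<ominus> b \<oplus> \<ominus> c) = \<ominus> b"
      using M.a_lcomm[of c "\<ominus> b" "\<ominus> c"] by (simp add: M.r_neg)
    moreover have "(b \<oplus> y) \<oplus> (\<ominus> b \<oplus> \<ominus> c) = (b \<oplus> \<ominus> b) \<oplus> (\<ominus> c \<oplus> y)"
      by (simp add: M.a_ac)
    then have "(b \<oplus> y) \<oplus> (\<ominus> b \<oplus> \<ominus> c) = \<ominus> c \<oplus> y" by (simp add: M.r_neg)
    ultimately show ?thesis by simp
  qed
  have mr: "(- r) \<odot> u = \<ominus> (r \<odot> u)" using smult_minus1[of "r \<odot> u"] by (simp add: smult_smult)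
  show ?thesis
    using u neg[of "r \<odot> u" g] neg[of g "r \<odot> u"] by (intro agreesI[of u y]) (auto simp: mr)
qed (use a in \<open>simp add: agrees_def\<close>)

lemma agrees_smult:
  assumes a: "agrees G p g r" and [simp]: "g \<in> carrier G"
  shows "agrees G p (c \<odot> g) (c * r)"
proof (cases "0 \<le> c")
  case False
  have "agrees G p ((- c) \<odot> g) (- c * r)" using agrees_smult_nonneg[OF a, of "- c"] False by simp
  from agrees_minus[OF this] smult_minus1[of "(- c) \<odot> g"] show ?thesis by (simp add: smult_smult)
qed (use agrees_smult_nonneg[OF a] in simp)

text \<open>With a common error y both elements are translated by the same amount, and translations
  commute with meets.\<close>

lemma agrees_vmeet:
  assumes a: "agrees G p g r" "agrees G p h s" and [simp]: "g \<in> carrier G" "h \<in> carrier G"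
  shows "agrees G p (g \<triangle> h) (min r s)"
proof (cases "p = {}")
  case False
  obtain u y where u: "u \<in> p" "y \<in> pos G" "y \<triangle> u = \<zero>" "g \<preceq> r \<odot> u \<oplus> y" "r \<odot> u \<preceq> g \<oplus> y"
    "h \<preceq> s \<odot> u \<oplus> y" "s \<odot> u \<preceq> h \<oplus> y" by (rule agrees_common[OF a False]) auto
  have [simp]: "u \<in> pos G" "y \<in> pos G" using u by auto
  have "g \<triangle> h \<preceq> (r \<odot> u \<oplus> y) \<triangle> (s \<odot> u \<oplus> y)" using u by (intro vmeet_mono) auto
  moreover have "r \<odot> u \<triangle> s \<odot> u \<preceq> (g \<oplus> y) \<triangle> (h \<oplus> y)" using u by (intro vmeet_mono) auto
  ultimately show ?thesis using u
    by (intro agreesI[of u y]) (auto simp: vmeet_add_right vmeet_smult_left)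
qed (use a in \<open>simp add: agrees_def\<close>)

text \<open>Truncation does not enlarge the error by \<open>tr_add_le\<close>, and its effect on r u
  is explicit by \<open>tr_smult_unital\<close>.\<close>

lemma agrees_truncation:
  assumes a: "agrees G p g r" and [simp]: "g \<in> pos G" and r: "0 \<le> r"
  shows "agrees G p (truncation G g) (min r 1)"
proof (cases "p = {}")
  case False
  obtain u y where u: "u \<in> p" "y \<in> pos G" "y \<triangle> u = \<zero>" "g \<preceq> r \<odot> u \<oplus> y" "r \<odot> u \<preceq> g \<oplus> y"
    by (rule agrees_common[OF a a False]) auto
  have [simp]: "u \<in> pos G" "y \<in> pos G" using u by auto
  have "truncation G g \<preceq> truncation G (r \<odot> u) \<oplus> y"
    "truncation G (r \<odot> u) \<preceq> truncation G g \<oplus> y"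
    using u r by (auto intro: tr_add_le)
  then show ?thesis using u r
    by (intro agreesI[of u y]) (auto simp: tr_smult_unital)
qed (use a in \<open>simp add: agrees_def\<close>)

end

text \<open>Turns the finite sums of \<open>simple_trunc\<close> into closure under the operations,
  so that no particular linear combination has to be handled later.\<close>

lemma (in trunc) simple_induct [consumes 2, case_names zero add smult unital]:
  assumes "simple_trunc G" "g \<in> carrier G"
    and zero: "P \<zero>" and add: "\<And>x y. \<lbrakk>x \<in> carrier G; y \<in> carrier G; P x; P y\<rbrakk> \<Longrightarrow> P (x \<oplus> y)"
    and smult: "\<And>r x. \<lbrakk>x \<in> carrier G; P x\<rbrakk> \<Longrightarrow> P ((r::real) \<odot> x)"
    and unital: "\<And>u. u \<in> unital_components G \<Longrightarrow> P u"
  shows "P g"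
proof -
  obtain U c where "finite U" "U \<subseteq> unital_components G" and g: "g = (\<Oplus>u\<in>U. (c u :: real) \<odot> u)"
    using assms(1,2) unfolding simple_trunc_def by blast
  from this(1,2) have "P (\<Oplus>u\<in>U. c u \<odot> u)"
  proof (induction U rule: finite_induct)
    case empty
    then show ?case by (simp add: zero)
  next
    case (insert u U)
    then have "(\<lambda>u. c u \<odot> u) \<in> U \<rightarrow> carrier G" "c u \<odot> u \<in> carrier G" by auto
    moreover have "P (c u \<odot> u)" using insert by (intro smult unital) auto
    ultimately show ?case using insert by (simp add: add M.finsum_closed)
  qed
  then show ?thesis by (simp add: g)
qed

section \<open>Evaluation at a prime as a truncation homomorphism\<close>

locale simple_trunc_prime = trunc_prime +
  assumes simple: "simple_trunc G"
begin

lemma agrees_evaluation: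
  assumes "g \<in> carrier G"
  shows "agrees G p g (evaluation G p g)"
proof -
  have "\<exists>r. agrees G p g r"
    using simple assms
  proof (induction rule: simple_induct)
    case zero
    then show ?case using agrees_unital[of \<zero>] by auto
  qed (auto intro: agrees_add agrees_smult agrees_unital)
  then have "\<exists>!r. agrees G p g r" using agrees_unique assms by blast
  then show ?thesis unfolding evaluation_def by (rule theI')
qed

lemma evaluation_eq:
  assumes "agrees G p g r" "g \<in> carrier G"
  shows "evaluation G p g = r"
  using agrees_unique[OF agrees_evaluation] assms by blast

lemma evaluation_unital:
  "u \<in> unital_components G \<Longrightarrow> evaluation G p u = (if u \<in> p then 1 else 0)"
  by (rule evaluation_eq[OF agrees_unital]) auto

lemma evaluation_zero [simp]: "evaluation G p \<zero> = 0"
  using evaluation_unital[of \<zero>] prime_zero by simp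

lemma evaluation_add:
  "\<lbrakk>g \<in> carrier G; h \<in> carrier G\<rbrakk> \<Longrightarrow> evaluation G p (g \<oplus> h) = evaluation G p g + evaluation G p h"
  by (rule evaluation_eq) (auto intro: agrees_add agrees_evaluation)

lemma evaluation_smult:
  "g \<in> carrier G \<Longrightarrow> evaluation G p (c \<odot> g) = c * evaluation G p g"
  by (rule evaluation_eq) (auto intro: agrees_smult agrees_evaluation)

lemma evaluation_minus: "g \<in> carrier G \<Longrightarrow> evaluation G p (\<ominus> g) = - evaluation G p g"
  by (rule evaluation_eq) (auto intro: agrees_minus agrees_evaluation)

lemma evaluation_vmeet:
  "\<lbrakk>g \<in> carrier G; h \<in> carrier G\<rbrakk>
    \<Longrightarrow> evaluation G p (g \<triangle> h) = min (evaluation G p g) (evaluation G p h)"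
  by (rule evaluation_eq) (auto intro: agrees_vmeet agrees_evaluation)

text \<open>Join and meet add up to the sum of the elements, just as maximum and minimum do for
  reals, so joins need no approximation argument of their own.\<close>

lemma evaluation_vjoin:
  assumes "g \<in> carrier G" "h \<in> carrier G"
  shows "evaluation G p (g \<nabla> h) = max (evaluation G p g) (evaluation G p h)"
  using assms evaluation_add[of "g \<nabla> h" "g \<triangle> h"] evaluation_add[of g h] evaluation_vmeet[of g h]
  by (simp add: vjoin_add_vmeet)

lemma evaluation_pos:
  assumes "g \<in> pos G"
  shows "0 \<le> evaluation G p g"
  using assms evaluation_vmeet[of \<zero> g] vmeet_absorb1[of \<zero> g] by (simp add: pos_ge_0)

lemma evaluation_truncation:
  "g \<in> pos G \<Longrightarrow> evaluation G p (truncation G g) = min (evaluation G p g) 1"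
  by (rule evaluation_eq[OF agrees_truncation[OF agrees_evaluation]]) (simp_all add: evaluation_pos)

end

section \<open>Evaluations separate points\<close>

context trunc
begin

text \<open>By induction every x is bounded in absolute value by some y disjoint from g; for x = g
  this y is above g and disjoint from it, so g is zero. Bounding x and its negative together carries
  the induction through negative scalars.\<close>

lemma eq_zero_if_disjoint_unital:
  assumes simple: "simple_trunc G" and [simp]: "g \<in> pos G"
    and dis: "\<And>u. u \<in> unital_components G \<Longrightarrow> u \<triangle> g = \<zero>"
  shows "g = \<zero>"
proof -
  have "\<exists>y\<in>pos G. y \<triangle> g = \<zero> \<and> x \<preceq> y \<and> \<ominus> x \<preceq> y" if "x \<in> carrier G" for x
    using simple that
  proof (induction rule: simple_induct)
    case zero
    have "\<ominus> \<zero> = \<zero>" by (rule M.minus_equality) auto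
    with vle_refl[of \<zero>] have "\<ominus> \<zero> \<preceq> \<zero>" by (simp only: M.zero_closed simp_thms)
    then show ?case by (intro bexI[of _ \<zero>]) (auto simp: vmeet_absorb1 pos_ge_0)
  next
    case (add x x')
    then obtain y y' where y: "y \<in> pos G" "y \<triangle> g = \<zero>" "x \<preceq> y" "\<ominus> x \<preceq> y"
      "y' \<in> pos G" "y' \<triangle> g = \<zero>" "x' \<preceq> y'" "\<ominus> x' \<preceq> y'" by blast
    then show ?case using add(1,2)
      by (intro bexI[of _ "y \<oplus> y'"]) (auto simp: M.minus_add intro!: disjoint_add add_mono2)
  next
    case (smult r x)
    then obtain y where y: "y \<in> pos G" "y \<triangle> g = \<zero>" "x \<preceq> y" "\<ominus> x \<preceq> y" by blast
    have "\<bar>r\<bar> \<odot> x \<preceq> \<bar>r\<bar> \<odot> y" "\<bar>r\<bar> \<odot> \<ominus> x \<preceq> \<bar>r\<bar> \<odot> y"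
      using y smult(1) by (auto intro!: smult_mono)
    moreover have "\<bar>r\<bar> \<odot> \<ominus> x = \<ominus> (\<bar>r\<bar> \<odot> x)"
      using smult(1) smult_minus1[of x] smult_minus1[of "\<bar>r\<bar> \<odot> x"] by (metis mult.commute smult_smult vsmult_closed)
    moreover have "r \<odot> x = \<bar>r\<bar> \<odot> x \<or> r \<odot> x = \<ominus> (\<bar>r\<bar> \<odot> x)"
      using smult(1) smult_minus1[of "\<bar>r\<bar> \<odot> x"] by (auto simp: abs_if smult_smult)
    ultimately show ?case using y smult(1)
      by (intro bexI[of _ "\<bar>r\<bar> \<odot> y"]) (auto simp: disjoint_smult)
  next
    case (unital u)
    have "\<ominus> u \<oplus> u \<preceq> u \<oplus> u"
      using unital by (simp add: M.l_neg pos_ge_0)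
    then have "\<ominus> u \<preceq> u" using unital by (simp add: add_le_cancel_right del: M.l_neg)
    then show ?case using unital dis by (intro bexI[of _ u]) auto
  qed
  then obtain y where "y \<in> pos G" "y \<triangle> g = \<zero>" "g \<preceq> y" by (meson assms(2) pos_carrier)
  then show ?thesis by (simp add: vmeet_absorb2)
qed

text \<open>If some u is not disjoint from f, there is a prime p that contains u and avoids the
  annihilator K of f. Agreement of f with 0 at p yields v in p and an upper bound of f disjoint from
  v; then v lies in K, a contradiction.\<close>

lemma eq_zero_if_evaluation_zero_pos:
  assumes simple: "simple_trunc G" and [simp]: "f \<in> pos G"
    and ev: "\<And>p. p \<in> primes (uc_lattice G) \<Longrightarrow> evaluation G p f = 0"
  shows "f = \<zero>"
proof (rule eq_zero_if_disjoint_unital[OF simple])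
  interpret L: generalized_boolean_algebra "uc_lattice G" by (rule uc_lattice_gba)
  define K where "K = {u \<in> unital_components G. u \<triangle> f = \<zero>}"
  fix u assume u: "u \<in> unital_components G"
  show "u \<triangle> f = \<zero>"
  proof (rule ccontr)
    assume "u \<triangle> f \<noteq> \<zero>"
    have down: "a \<in> K" if "a \<in> unital_components G" "b \<in> K" "a \<preceq> b" for a b
      using that disjoint_mono[of b f a f] by (auto simp: K_def)
    have join: "a \<nabla> b \<in> K" if "a \<in> K" "b \<in> K" for a b
    proof -
      have ab: "a \<in> unital_components G" "b \<in> unital_components G" using that by (auto simp: K_def)
      then have [simp]: "a \<in> pos G" "b \<in> pos G" by auto
      have "(a \<oplus> b) \<triangle> f = \<zero>" using that by (intro disjoint_add) (auto simp: K_def)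
      then have "(a \<nabla> b) \<triangle> f = \<zero>"
        by (rule disjoint_mono) (auto intro!: vjoin_least simp: le_add_pos1 le_add_pos2)
      then show ?thesis using ab by (simp add: K_def)
    qed
    have K: "K \<subseteq> unital_components G" "u \<notin> K" "\<zero> \<in> K"
      using \<open>u \<triangle> f \<noteq> \<zero>\<close> by (auto simp: K_def vmeet_absorb1 pos_ge_0)
    obtain p where p: "p \<in> primes (uc_lattice G)" "u \<in> p" "p \<inter> K = {}"
    proof (rule L.prime_separation[of K u])
      fix a b assume ab: "a \<in> K" "b \<in> K"
      then have "a \<in> unital_components G" "b \<in> unital_components G" using K by auto
      then show "a \<squnion>\<^bsub>uc_lattice G\<^esub> b \<in> K" using join ab by (simp add: uc_lattice_join)
    qed (use u K down in \<open>auto simp: uc_lattice_bottom\<close>)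
    interpret simple_trunc_prime G p by unfold_locales (rule p simple)+
    have "agrees G p f 0" using agrees_evaluation[of f] ev[OF p(1)] by simp
    \<comment> \<open>As u lies in p, the clause of \<open>agrees\<close> for the empty prime is
      excluded.\<close>
    then obtain v y where v: "v \<in> p" "y \<in> pos G" "y \<triangle> v = \<zero>" "f \<preceq> (0::real) \<odot> v \<oplus> y"
      using p(2) unfolding agrees_def by blast
    then have v': "v \<in> unital_components G" "v \<in> pos G" "f \<preceq> y" by auto
    then have "f \<triangle> v = \<zero>" using v by (intro disjoint_mono[of y v f v]) auto
    then have "v \<in> K" using v' by (simp add: K_def vmeet_commute)
    then show False using p v by blast
  qed
qed simp

text \<open>The positive part of the difference has value 0 at every prime, hence is zero. This
  gives one inequality, and symmetry gives the other.\<close>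

lemma evaluation_inject:
  assumes simple: "simple_trunc G" and [simp]: "g \<in> carrier G" "h \<in> carrier G"
    and ev: "\<And>p. p \<in> primes (uc_lattice G) \<Longrightarrow> evaluation G p g = evaluation G p h"
  shows "g = h"
proof -
  have le: "x \<preceq> y" if [simp]: "x \<in> carrier G" "y \<in> carrier G"
    and ev: "\<And>p. p \<in> primes (uc_lattice G) \<Longrightarrow> evaluation G p x = evaluation G p y" for x y
  proof -
    have "\<zero> \<nabla> (x \<oplus> \<ominus> y) = \<zero>"
    proof (rule eq_zero_if_evaluation_zero_pos[OF simple])
      fix p assume p: "p \<in> primes (uc_lattice G)"
      interpret simple_trunc_prime G p by unfold_locales (rule p simple)+
      show "evaluation G p (\<zero> \<nabla> (x \<oplus> \<ominus> y)) = 0"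
        by (simp add: evaluation_vjoin evaluation_add evaluation_minus ev[OF p])
    qed simp
    then have "x \<ominus> y \<preceq> \<zero>" using vjoin_right[of \<zero> "x \<ominus> y"] by (simp add: M.minus_eq)
    then show ?thesis by (simp add: diff_le_iff)
  qed
  show ?thesis by (rule vle_antisym) (auto intro: le simp: ev)
qed

end

section \<open>Fully faithful and essentially surjective functors\<close>

lemma cat_functor_id: "category C \<Longrightarrow> cat_functor C C id_functor"
  by (simp add: cat_functor_def cat_functor_axioms_def id_functor_def)

lemma cat_functor_comp:
  assumes "cat_functor C D F" "cat_functor D E G"
  shows "cat_functor C E (comp_functor G F)"
proof -
  interpret F: cat_functor C D F by fact
  interpret G: cat_functor D E G by fact
  show ?thesis
    by unfold_locales (auto simp: comp_functor_def F.FObj_in_Obj G.FObj_in_Obj F.FMap_in_Hom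
        G.FMap_in_Hom F.FMap_Id G.FMap_Id F.FMap_Comp G.FMap_Comp)
qed

text \<open>The usual construction of a quasi-inverse: essential surjectivity provides objects and
  isomorphisms to choose from, and a morphism is conjugated by the chosen isomorphisms and then
  lifted along the bijection of Hom-sets.\<close>

lemma equivalence_if_fully_faithful_essentially_surjective:
  assumes "cat_functor C D F"
    and bij: "\<And>x y. \<lbrakk>x \<in> Obj C; y \<in> Obj C\<rbrakk>
      \<Longrightarrow> bij_betw (FMap F x y) (Hom C x y) (Hom D (FObj F x) (FObj F y))"
    and surj: "\<And>d. d \<in> Obj D \<Longrightarrow> \<exists>c\<in>Obj C. \<exists>e. iso_in D (FObj F c) d e"
  shows "equivalence_of_categories C D F"
proof -
  interpret F: cat_functor C D F by fact
  note [simp] = F.FObj_in_Obj F.FMap_in_Hom F.FMap_Id F.FMap_Comp F.C.Id_in_Hom F.D.Id_in_Hom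
    F.C.Comp_in_Hom F.D.Comp_in_Hom F.C.Comp_Id F.D.Comp_Id F.C.Id_Comp F.D.Id_Comp
  have "\<exists>c e e'. c \<in> Obj C \<and> e \<in> Hom D (FObj F c) d \<and> e' \<in> Hom D d (FObj F c) \<and>
      Comp D (FObj F c) d (FObj F c) e' e = Id D (FObj F c) \<and>
      Comp D d (FObj F c) d e e' = Id D d" if "d \<in> Obj D" for d
    using surj[OF that] unfolding iso_in_def by blast
  then obtain G0 e e' where G0 [simp]: "\<And>d. d \<in> Obj D \<Longrightarrow> G0 d \<in> Obj C"
    and e [simp]: "\<And>d. d \<in> Obj D \<Longrightarrow> e d \<in> Hom D (FObj F (G0 d)) d"
    and e' [simp]: "\<And>d. d \<in> Obj D \<Longrightarrow> e' d \<in> Hom D d (FObj F (G0 d))"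
    and e'e [simp]: "\<And>d. d \<in> Obj D \<Longrightarrow> Comp D (FObj F (G0 d)) d (FObj F (G0 d)) (e' d) (e d) = Id D (FObj F (G0 d))"
    and ee' [simp]: "\<And>d. d \<in> Obj D \<Longrightarrow> Comp D d (FObj F (G0 d)) d (e d) (e' d) = Id D d"
    by metis
  define lift where "lift x y = inv_into (Hom C x y) (FMap F x y)" for x y
  have F_lift [simp]: "FMap F x y (lift x y h) = h" and lift_Hom [simp]: "lift x y h \<in> Hom C x y"
    if "x \<in> Obj C" "y \<in> Obj C" "h \<in> Hom D (FObj F x) (FObj F y)" for x y h
    using bij[OF that(1,2)] that(3) unfolding lift_def
    by (simp_all add: bij_betw_def f_inv_into_f inv_into_into)
  \<comment> \<open>Equations in C are checked after applying F, where the lifts disappear.\<close>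
  have faithful: "f = g" if "x \<in> Obj C" "y \<in> Obj C" "f \<in> Hom C x y" "g \<in> Hom C x y"
      "FMap F x y f = FMap F x y g" for x y f g
    using bij[OF that(1,2)] that(3-) by (auto simp: bij_betw_def inj_on_def)
  \<comment> \<open>The conjugate of h by the chosen isomorphisms: \<open>e d\<close> first, then h,
    then the inverse \<open>e' d'\<close>.\<close>
  define conj where "conj d d' h = Comp D (FObj F (G0 d)) d' (FObj F (G0 d')) (e' d')
    (Comp D (FObj F (G0 d)) d d' h (e d))" for d d' h
  have conj_Hom [simp]: "conj d d' h \<in> Hom D (FObj F (G0 d)) (FObj F (G0 d'))"
    if "d \<in> Obj D" "d' \<in> Obj D" "h \<in> Hom D d d'" for d d' h
    using that unfolding conj_def by simp
  have conj_e': "Comp D d (FObj F (G0 d)) (FObj F (G0 d')) (conj d d' h) (e' d) = Comp D d d' (FObj F (G0 d')) (e' d') h"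
    and e_conj: "Comp D (FObj F (G0 d)) (FObj F (G0 d')) d' (e d') (conj d d' h) = Comp D (FObj F (G0 d)) d d' h (e d)"
    if "d \<in> Obj D" "d' \<in> Obj D" "h \<in> Hom D d d'" for d d' h
  proof -
    show "Comp D d (FObj F (G0 d)) (FObj F (G0 d')) (conj d d' h) (e' d) = Comp D d d' (FObj F (G0 d')) (e' d') h"
      using that unfolding conj_def by (simp add: F.D.Comp_assoc)
    have "Comp D (FObj F (G0 d)) (FObj F (G0 d')) d' (e d') (conj d d' h)
      = Comp D (FObj F (G0 d)) d' d' (Comp D d' (FObj F (G0 d')) d' (e d') (e' d')) (Comp D (FObj F (G0 d)) d d' h (e d))"
      using that unfolding conj_def by (simp add: F.D.Comp_assoc del: ee')
    then show "Comp D (FObj F (G0 d)) (FObj F (G0 d')) d' (e d') (conj d d' h) = Comp D (FObj F (G0 d)) d d' h (e d)"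
      using that by simp
  qed
  have conj_Comp: "conj d d'' (Comp D d d' d'' k h)
      = Comp D (FObj F (G0 d)) (FObj F (G0 d')) (FObj F (G0 d'')) (conj d' d'' k) (conj d d' h)"
    if "d \<in> Obj D" "d' \<in> Obj D" "d'' \<in> Obj D" "h \<in> Hom D d d'" "k \<in> Hom D d' d''" for d d' d'' h k
  proof -
    have "Comp D (FObj F (G0 d)) (FObj F (G0 d')) (FObj F (G0 d'')) (conj d' d'' k) (conj d d' h)
      = Comp D (FObj F (G0 d)) d'' (FObj F (G0 d'')) (e' d'') (Comp D (FObj F (G0 d)) d' d'' k
         (Comp D (FObj F (G0 d)) (FObj F (G0 d')) d' (e d') (conj d d' h)))"
      using that unfolding conj_def[of d' d''] by (simp add: F.D.Comp_assoc)
    also have "\<dots> = conj d d'' (Comp D d d' d'' k h)"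
      using that unfolding e_conj[OF that(1,2,4)] by (simp add: conj_def F.D.Comp_assoc)
    finally show ?thesis by simp
  qed
  define G where "G = \<lparr>FObj = G0, FMap = (\<lambda>d d' h. lift (G0 d) (G0 d') (conj d d' h))\<rparr>"
  have GObj [simp]: "FObj G = G0"
    and GMap [simp]: "FMap G d d' h = lift (G0 d) (G0 d') (conj d d' h)" for d d' h
    by (simp_all add: G_def)
  have G: "cat_functor D C G"
  proof unfold_locales
    fix x assume x: "x \<in> Obj D"
    then have "conj x x (Id D x) = Id D (FObj F (G0 x))" by (simp add: conj_def)
    with x show "FMap G x x (Id D x) = Id C (FObj G x)"
      by (auto intro!: faithful[of "G0 x" "G0 x"])
  next
    fix x y z f g
    assume *: "x \<in> Obj D" "y \<in> Obj D" "z \<in> Obj D" "f \<in> Hom D x y" "g \<in> Hom D y z"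
    then show "FMap G x z (Comp D x y z g f)
      = Comp C (FObj G x) (FObj G y) (FObj G z) (FMap G y z g) (FMap G x y f)"
      by (auto intro!: faithful[of "G0 x" "G0 z"] simp: conj_Comp)
  qed auto
  interpret GF: cat_functor C C "comp_functor G F" by (rule cat_functor_comp) fact+
  interpret FG: cat_functor D D "comp_functor F G" by (rule cat_functor_comp) fact+
  interpret idC: cat_functor C C id_functor by (rule cat_functor_id) unfold_locales
  interpret idD: cat_functor D D id_functor by (rule cat_functor_id) unfold_locales
  \<comment> \<open>The unit at x is the lift of \<open>e'\<close> at \<open>FObj F x\<close>, with
    inverse the lift of e at the same object; the counit is e itself.\<close>
  have "natural_isomorphism C C id_functor (comp_functor G F) (\<lambda>x. lift x (G0 (FObj F x)) (e' (FObj F x)))"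
  proof unfold_locales
    fix x assume x: "x \<in> Obj C"
    let ?y = "G0 (FObj F x)"
    have "Comp C x ?y x (lift ?y x (e (FObj F x))) (lift x ?y (e' (FObj F x))) = Id C x"
      using x by (intro faithful[of x x]) auto
    moreover have "Comp C ?y x ?y (lift x ?y (e' (FObj F x))) (lift ?y x (e (FObj F x))) = Id C ?y"
      using x by (intro faithful[of ?y ?y]) auto
    ultimately show "iso_in C (FObj id_functor x) (FObj (comp_functor G F) x) (lift x ?y (e' (FObj F x)))"
      unfolding iso_in_def using x
      by (auto simp: id_functor_def comp_functor_def intro!: bexI[of _ "lift ?y x (e (FObj F x))"])
  next
    fix x y f assume *: "x \<in> Obj C" "y \<in> Obj C" "f \<in> Hom C x y"
    show "Comp C (FObj id_functor x) (FObj id_functor y) (FObj (comp_functor G F) y)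
         (lift y (G0 (FObj F y)) (e' (FObj F y))) (FMap id_functor x y f)
       = Comp C (FObj id_functor x) (FObj (comp_functor G F) x) (FObj (comp_functor G F) y)
         (FMap (comp_functor G F) x y f) (lift x (G0 (FObj F x)) (e' (FObj F x)))"
      unfolding id_functor_def comp_functor_def using *
      by (intro faithful[of x "G0 (FObj F y)"]) (auto simp: conj_e')
  qed
  moreover have "natural_isomorphism D D (comp_functor F G) id_functor e"
  proof unfold_locales
    fix x assume "x \<in> Obj D"
    then show "iso_in D (FObj (comp_functor F G) x) (FObj id_functor x) (e x)"
      unfolding iso_in_def by (auto simp: id_functor_def comp_functor_def intro!: bexI[of _ "e' x"])
  next
    fix x y f assume "x \<in> Obj D" "y \<in> Obj D" "f \<in> Hom D x y"
    then show "Comp D (FObj (comp_functor F G) x) (FObj (comp_functor F G) y) (FObj id_functor y)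
         (e y) (FMap (comp_functor F G) x y f)
       = Comp D (FObj (comp_functor F G) x) (FObj id_functor x) (FObj id_functor y)
         (FMap id_functor x y f) (e x)"
      by (simp add: id_functor_def comp_functor_def e_conj)
  qed
  ultimately show ?thesis
    unfolding equivalence_of_categories_def using assms(1) G by blast
qed


section \<open>The functor of unital components\<close>

lemma vlat_hom_PiE: "f \<in> vlat_hom G H \<Longrightarrow> f \<in> carrier G \<rightarrow>\<^sub>E carrier H"
  by (simp add: vlat_hom_def)

lemma vlat_hom_closed: "\<lbrakk>f \<in> vlat_hom G H; x \<in> carrier G\<rbrakk> \<Longrightarrow> f x \<in> carrier H"
  by (auto simp: vlat_hom_def)

lemma vlat_hom_simps:
  assumes "f \<in> vlat_hom G H" "x \<in> carrier G"
  shows "f ((r::real) \<odot>\<^bsub>G\<^esub> x) = r \<odot>\<^bsub>H\<^esub> f x"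
    and "y \<in> carrier G \<Longrightarrow> f (x \<oplus>\<^bsub>G\<^esub> y) = f x \<oplus>\<^bsub>H\<^esub> f y"
    and "y \<in> carrier G \<Longrightarrow> f (x \<triangle>\<^bsub>G\<^esub> y) = f x \<triangle>\<^bsub>H\<^esub> f y"
    and "y \<in> carrier G \<Longrightarrow> f (x \<nabla>\<^bsub>G\<^esub> y) = f x \<nabla>\<^bsub>H\<^esub> f y"
  using assms by (simp_all add: vlat_hom_def)

lemma trunc_hom_vlat_hom: "f \<in> trunc_hom G H \<Longrightarrow> f \<in> vlat_hom G H"
  by (simp add: trunc_hom_def)

lemma trunc_hom_PiE: "f \<in> trunc_hom G H \<Longrightarrow> f \<in> carrier G \<rightarrow>\<^sub>E carrier H"
  by (simp add: trunc_hom_def vlat_hom_def)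

lemma trunc_hom_truncation:
  "\<lbrakk>f \<in> trunc_hom G H; g \<in> pos G\<rbrakk> \<Longrightarrow> f (truncation G g) = truncation H (f g)"
  by (simp add: trunc_hom_def)

lemma vlat_hom_zero:
  assumes "vector_lattice G" "vector_lattice H" "f \<in> vlat_hom G H"
  shows "f \<zero>\<^bsub>G\<^esub> = \<zero>\<^bsub>H\<^esub>"
proof -
  interpret G: vector_lattice G by fact
  interpret H: vector_lattice H by fact
  have "f ((0::real) \<odot>\<^bsub>G\<^esub> \<zero>\<^bsub>G\<^esub>) = (0::real) \<odot>\<^bsub>H\<^esub> f \<zero>\<^bsub>G\<^esub>"
    using assms(3) by (intro vlat_hom_simps) auto
  then show ?thesis using vlat_hom_closed[OF assms(3), of "\<zero>\<^bsub>G\<^esub>"] by simp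
qed

text \<open>Positivity of x is the equation between x and its join with zero, which homomorphisms
  preserve.\<close>

lemma vlat_hom_pos:
  assumes "vector_lattice G" "vector_lattice H" "f \<in> vlat_hom G H" "x \<in> pos G"
  shows "f x \<in> pos H"
proof -
  interpret G: vector_lattice G by fact
  interpret H: vector_lattice H by fact
  have [simp]: "x \<in> carrier G" using assms(4) by simp
  have [simp]: "f x \<in> carrier H" using vlat_hom_closed[OF assms(3)] by simp
  have "f x = f (\<zero>\<^bsub>G\<^esub> \<nabla>\<^bsub>G\<^esub> x)" using assms by (simp add: G.vjoin_absorb2 G.pos_ge_0)
  also have "\<dots> = \<zero>\<^bsub>H\<^esub> \<nabla>\<^bsub>H\<^esub> f x" using assms by (simp add: vlat_hom_simps vlat_hom_zero)
  also have "\<dots> \<in> pos H" by simp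
  finally show ?thesis .
qed

lemma compose_vlat_hom:
  assumes "vector_lattice G" "f \<in> vlat_hom G H" "g \<in> vlat_hom H K"
  shows "compose (carrier G) g f \<in> vlat_hom G K"
proof -
  interpret G: vector_lattice G by fact
  show ?thesis
    using assms(2,3) vlat_hom_closed[OF assms(2)] vlat_hom_closed[OF assms(3)]
    by (auto simp: vlat_hom_def[of G K] compose_def vlat_hom_simps[OF assms(2)] vlat_hom_simps[OF assms(3)])
qed

lemma trunc_vector_lattice: "trunc G \<Longrightarrow> vector_lattice G"
  by (simp add: trunc_def archimedean_vector_lattice_def)

lemma compose_trunc_hom:
  assumes "trunc G" "trunc H" "f \<in> trunc_hom G H" "g \<in> trunc_hom H K"
  shows "compose (carrier G) g f \<in> trunc_hom G K"
proof -
  interpret G: trunc G by fact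
  have "f x \<in> pos H" if "x \<in> pos G" for x
    using assms that by (blast intro: vlat_hom_pos trunc_vector_lattice trunc_hom_vlat_hom)
  then have "compose (carrier G) g f (truncation G x) = truncation K (compose (carrier G) g f x)"
    if "x \<in> pos G" for x
    using that by (simp add: compose_def trunc_hom_truncation[OF assms(3)]
        trunc_hom_truncation[OF assms(4)])
  moreover have "compose (carrier G) g f \<in> vlat_hom G K"
    using assms(1,3,4) by (blast intro: compose_vlat_hom trunc_vector_lattice trunc_hom_vlat_hom)
  ultimately show ?thesis by (simp add: trunc_hom_def)
qed

lemma Id_trunc_hom:
  assumes "trunc G"
  shows "(\<lambda>x\<in>carrier G. x) \<in> trunc_hom G G"
proof -
  interpret G: trunc G by fact
  show ?thesis by (auto simp: trunc_hom_def vlat_hom_def)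
qed

lemma simple_truncs_cat_simps [simp]:
  "Obj simple_truncs_cat = {G. trunc G \<and> simple_trunc G}"
  "Hom simple_truncs_cat = trunc_hom"
  "Id simple_truncs_cat = (\<lambda>G. \<lambda>x \<in> carrier G. x)"
  "Comp simple_truncs_cat = (\<lambda>G H K g f. compose (carrier G) g f)"
  by (simp_all add: simple_truncs_cat_def full_subcategory_def truncs_cat_def)

lemma gba_cat_simps [simp]:
  "Obj gba_cat = {L. generalized_boolean_algebra L}"
  "Hom gba_cat = gba_hom"
  "Id gba_cat = (\<lambda>L. \<lambda>x \<in> carrier L. x)"
  "Comp gba_cat = (\<lambda>L M N g f. compose (carrier L) g f)"
  by (simp_all add: gba_cat_def)

lemma compose_PiE_Id: "f \<in> A \<rightarrow>\<^sub>E B \<Longrightarrow> compose A f (\<lambda>x\<in>A. x) = f"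
  by (auto simp: compose_def PiE_def extensional_def)

lemma Id_compose_PiE: "f \<in> A \<rightarrow>\<^sub>E B \<Longrightarrow> compose A (\<lambda>x\<in>B. x) f = f"
  by (auto simp: compose_def PiE_def extensional_def Pi_def fun_eq_iff)

lemma compose_PiE_assoc:
  "f \<in> A \<rightarrow>\<^sub>E B \<Longrightarrow> compose A (compose B h g) f = compose A h (compose A g f)"
  by (auto simp: compose_def PiE_def Pi_def fun_eq_iff)

lemma gba_hom_PiE: "f \<in> gba_hom L M \<Longrightarrow> f \<in> carrier L \<rightarrow>\<^sub>E carrier M"
  by (simp add: gba_hom_def)

lemma category_simple_truncs_cat: "category simple_truncs_cat"
  by unfold_locales
    (auto simp: Id_trunc_hom intro: compose_trunc_hom compose_PiE_assoc[OF trunc_hom_PiE]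
      compose_PiE_Id[OF trunc_hom_PiE] Id_compose_PiE[OF trunc_hom_PiE])

lemma compose_gba_hom:
  assumes "generalized_boolean_algebra L" "f \<in> gba_hom L M" "g \<in> gba_hom M N"
  shows "compose (carrier L) g f \<in> gba_hom L N"
proof -
  interpret generalized_boolean_algebra L by fact
  have "f x \<in> carrier M" if "x \<in> carrier L" for x using assms(2) that by (auto simp: gba_hom_def)
  then show ?thesis using assms(2,3) by (auto simp: gba_hom_def compose_def)
qed

lemma Id_gba_hom:
  assumes "generalized_boolean_algebra L"
  shows "(\<lambda>x\<in>carrier L. x) \<in> gba_hom L L"
proof -
  interpret generalized_boolean_algebra L by fact
  show ?thesis by (auto simp: gba_hom_def)
qed

lemma category_gba_cat: "category gba_cat"
  by unfold_locales
    (auto simp: Id_gba_hom intro: compose_gba_hom compose_PiE_assoc[OF gba_hom_PiE]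
      compose_PiE_Id[OF gba_hom_PiE] Id_compose_PiE[OF gba_hom_PiE])

lemma UC_simps [simp]:
  "FObj UC G = uc_lattice G"
  "FMap UC G H f = restrict f (unital_components G)"
  by (simp_all add: UC_def uc_lattice_def)

text \<open>Homomorphisms preserve the equation saying that u is the truncation of 2u, whereas the
  definition of a unital component quantifies over all truncated elements of the codomain.\<close>

lemma trunc_hom_unital:
  assumes "trunc G" "trunc H" "f \<in> trunc_hom G H" "u \<in> unital_components G"
  shows "f u \<in> unital_components H"
proof -
  interpret G: trunc G by fact
  interpret H: trunc H by fact
  have f: "f \<in> vlat_hom G H" using assms(3) by (rule trunc_hom_vlat_hom)
  have [simp]: "u \<in> pos G" using assms by simp
  have "f u \<in> pos H"
    using vlat_hom_pos[OF G.vector_lattice_axioms H.vector_lattice_axioms f] by simp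
  moreover have "f (truncation G ((2::real) \<odot>\<^bsub>G\<^esub> u)) = truncation H ((2::real) \<odot>\<^bsub>H\<^esub> f u)"
    by (simp add: trunc_hom_truncation[OF assms(3)] G.pos_smult vlat_hom_simps(1)[OF f])
  ultimately show ?thesis using assms by (simp add: H.unital_components_iff G.unital_tr_2)
qed

lemma restrict_trunc_hom:
  assumes "trunc G" "trunc H" "f \<in> trunc_hom G H"
  shows "restrict f (unital_components G) \<in> gba_hom (uc_lattice G) (uc_lattice H)"
proof -
  interpret G: trunc G by fact
  interpret H: trunc H by fact
  have f: "f \<in> vlat_hom G H" using assms(3) by (rule trunc_hom_vlat_hom)
  note u = trunc_hom_unital[OF assms]
  show ?thesis
    using vlat_hom_zero[OF G.vector_lattice_axioms H.vector_lattice_axioms f]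
    by (auto simp: gba_hom_def u G.uc_lattice_meet G.uc_lattice_join G.uc_lattice_bottom
      H.uc_lattice_meet H.uc_lattice_join H.uc_lattice_bottom vlat_hom_simps[OF f])
qed

lemma UC_cat_functor: "cat_functor simple_truncs_cat gba_cat UC"
proof (intro cat_functor.intro category_simple_truncs_cat category_gba_cat, unfold_locales)
  fix x :: "'a trunc"
  assume "x \<in> Obj simple_truncs_cat"
  then interpret trunc x by simp
  show "FObj UC x \<in> Obj gba_cat" using uc_lattice_gba by simp
  have "unital_components x \<subseteq> carrier x" by auto
  then show "FMap UC x x (Id simple_truncs_cat x) = Id gba_cat (FObj UC x)"
    by (auto simp: fun_eq_iff subset_iff)
next
  fix x y :: "'a trunc" and f
  assume "x \<in> Obj simple_truncs_cat" "y \<in> Obj simple_truncs_cat" "f \<in> Hom simple_truncs_cat x y"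
  then show "FMap UC x y f \<in> Hom gba_cat (FObj UC x) (FObj UC y)"
    by (simp add: restrict_trunc_hom)
next
  fix x y z :: "'a trunc" and f g
  assume *: "x \<in> Obj simple_truncs_cat" "y \<in> Obj simple_truncs_cat" "z \<in> Obj simple_truncs_cat"
    "f \<in> Hom simple_truncs_cat x y" "g \<in> Hom simple_truncs_cat y z"
  then interpret trunc x by simp
  have "unital_components x \<subseteq> carrier x" by auto
  then show "FMap UC x z (Comp simple_truncs_cat x y z g f)
    = Comp gba_cat (FObj UC x) (FObj UC y) (FObj UC z) (FMap UC y z g) (FMap UC x y f)"
    using * trunc_hom_unital[of x y f] by (auto simp: fun_eq_iff compose_def subset_iff)
qed

section \<open>Faithfulness and fullness\<close>

lemma UC_faithful:
  assumes "trunc G" "simple_trunc G"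
  shows "inj_on (\<lambda>f. restrict f (unital_components G)) (trunc_hom G H)"
proof (rule inj_onI)
  interpret G: trunc G by fact
  fix f g
  assume f: "f \<in> trunc_hom G H" and g: "g \<in> trunc_hom G H"
    and eq: "restrict f (unital_components G) = restrict g (unital_components G)"
  note fg = trunc_hom_vlat_hom[OF f] trunc_hom_vlat_hom[OF g]
  have "f x = g x" if "x \<in> carrier G" for x
    using assms(2) that
  proof (induction rule: G.simple_induct)
    case zero
    show ?case using fun_cong[OF eq, of "\<zero>\<^bsub>G\<^esub>"] by simp
  next
    case (unital u)
    then show ?case using fun_cong[OF eq, of u] by simp
  qed (simp_all add: vlat_hom_simps[OF fg(1)] vlat_hom_simps[OF fg(2)])
  then show "f = g" using fg[THEN vlat_hom_PiE] by (auto intro: PiE_ext)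
qed

text \<open>Nothing forces the range of \<phi> to meet q, so the preimage may be empty even when q
  is not.\<close>

lemma primes_vimage:
  assumes G: "trunc G" and H: "trunc H" and \<phi>: "\<phi> \<in> gba_hom (uc_lattice G) (uc_lattice H)"
    and q: "q \<in> primes (uc_lattice H)"
  shows "{u \<in> unital_components G. \<phi> u \<in> q} \<in> primes (uc_lattice G)"
proof -
  interpret G: trunc G by fact
  interpret H: trunc_prime H q using H q by (simp add: trunc_prime_def trunc_prime_axioms_def)
  have "\<phi> u \<in> unital_components H" if "u \<in> unital_components G" for u
    using \<phi> that by (auto simp: gba_hom_def)
  moreover have "\<phi> \<zero>\<^bsub>G\<^esub> = \<zero>\<^bsub>H\<^esub>"
    using \<phi> by (simp add: gba_hom_def G.uc_lattice_bottom H.uc_lattice_bottom)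
  moreover have "\<phi> (u \<triangle>\<^bsub>G\<^esub> v) = \<phi> u \<triangle>\<^bsub>H\<^esub> \<phi> v" "\<phi> (u \<nabla>\<^bsub>G\<^esub> v) = \<phi> u \<nabla>\<^bsub>H\<^esub> \<phi> v"
    if "u \<in> unital_components G" "v \<in> unital_components G" for u v
    using \<phi> that calculation(1)
    by (auto simp: gba_hom_def G.uc_lattice_meet G.uc_lattice_join H.uc_lattice_meet H.uc_lattice_join)
  ultimately show ?thesis
    by (auto simp: primes_def[of "uc_lattice G"] G.uc_lattice_bottom H.prime_zero G.uc_lattice_meet
        G.uc_lattice_join H.prime_vmeet H.prime_vjoin)
qed

text \<open>
  The extension of \<open>\<phi>\<close> sends \<open>g\<close> to the unique \<open>h\<close> whose value at each prime \<open>q\<close> is the value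
  of \<open>g\<close> at the prime \<open>\<phi>\<^sup>-\<^sup>1(q)\<close>.
\<close>

lemma UC_full:
  assumes G: "trunc G" "simple_trunc G" and H: "trunc H" "simple_trunc H"
    and \<phi>: "\<phi> \<in> gba_hom (uc_lattice G) (uc_lattice H)"
  shows "\<exists>f\<in>trunc_hom G H. restrict f (unital_components G) = \<phi>"
proof -
  interpret G: trunc G by fact
  interpret H: trunc H by fact
  \<comment> \<open>As a relation, the extension can be shown to respect all operations before
    existence and uniqueness of h are known.\<close>
  define rel where "rel g h \<longleftrightarrow> h \<in> carrier H \<and> (\<forall>q\<in>primes (uc_lattice H).
    evaluation H q h = evaluation G {u \<in> unital_components G. \<phi> u \<in> q} g)" for g h
  have loc: "simple_trunc_prime G {u \<in> unital_components G. \<phi> u \<in> q}" "simple_trunc_prime H q"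
    if "q \<in> primes (uc_lattice H)" for q
    using G H that primes_vimage[OF G(1) H(1) \<phi> that]
    by (simp_all add: simple_trunc_prime_def trunc_prime_def simple_trunc_prime_axioms_def trunc_prime_axioms_def)
  have \<phi>_closed: "\<phi> u \<in> unital_components H" if "u \<in> unital_components G" for u
    using \<phi> that by (auto simp: gba_hom_def)
  have rel_carrier: "h \<in> carrier H" if "rel g h" for g h
    using that by (simp add: rel_def)
  have rel_unital: "rel u (\<phi> u)" if "u \<in> unital_components G" for u
    using that \<phi>_closed by (auto simp: rel_def simple_trunc_prime.evaluation_unital[OF loc(1)]
        simple_trunc_prime.evaluation_unital[OF loc(2)])
  have rel_add: "rel (x \<oplus>\<^bsub>G\<^esub> x') (y \<oplus>\<^bsub>H\<^esub> y')"
    if "rel x y" "rel x' y'" "x \<in> carrier G" "x' \<in> carrier G" for x x' y y'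
    using that by (auto simp: rel_def simple_trunc_prime.evaluation_add[OF loc(1)]
        simple_trunc_prime.evaluation_add[OF loc(2)])
  have rel_smult: "rel (r \<odot>\<^bsub>G\<^esub> x) (r \<odot>\<^bsub>H\<^esub> y)" if "rel x y" "x \<in> carrier G" for r x y
    using that by (auto simp: rel_def simple_trunc_prime.evaluation_smult[OF loc(1)]
        simple_trunc_prime.evaluation_smult[OF loc(2)])
  have rel_vmeet: "rel (x \<triangle>\<^bsub>G\<^esub> x') (y \<triangle>\<^bsub>H\<^esub> y')"
    if "rel x y" "rel x' y'" "x \<in> carrier G" "x' \<in> carrier G" for x x' y y'
    using that by (auto simp: rel_def simple_trunc_prime.evaluation_vmeet[OF loc(1)]
        simple_trunc_prime.evaluation_vmeet[OF loc(2)])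
  have rel_vjoin: "rel (x \<nabla>\<^bsub>G\<^esub> x') (y \<nabla>\<^bsub>H\<^esub> y')"
    if "rel x y" "rel x' y'" "x \<in> carrier G" "x' \<in> carrier G" for x x' y y'
    using that by (auto simp: rel_def simple_trunc_prime.evaluation_vjoin[OF loc(1)]
        simple_trunc_prime.evaluation_vjoin[OF loc(2)])
  have rel_tr: "rel (truncation G x) (truncation H y)" if "rel x y" "x \<in> pos G" "y \<in> pos H" for x y
    using that by (auto simp: rel_def simple_trunc_prime.evaluation_truncation[OF loc(1)]
        simple_trunc_prime.evaluation_truncation[OF loc(2)])
  have unique: "h = h'" if "rel g h" "rel g h'" for g h h'
    using that by (intro H.evaluation_inject[OF H(2)]) (auto simp: rel_def)
  have "\<exists>h. rel g h" if "g \<in> carrier G" for g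
    using G(2) that
  proof (induction rule: G.simple_induct)
    case zero
    show ?case using rel_unital[of "\<zero>\<^bsub>G\<^esub>"] by auto
  qed (auto intro: rel_add rel_smult rel_unital)
  then obtain f0 where f0: "\<And>g. g \<in> carrier G \<Longrightarrow> rel g (f0 g)" by metis
  define f where "f = restrict f0 (carrier G)"
  have rel_f: "rel g (f g)" if "g \<in> carrier G" for g using f0 that by (simp add: f_def)
  have f_eq: "f g = h" if "rel g h" "g \<in> carrier G" for g h
    using unique[OF rel_f that(1)] that(2) by simp
  have f_hom: "f \<in> vlat_hom G H"
  proof -
    have "f \<in> carrier G \<rightarrow>\<^sub>E carrier H" using rel_carrier[OF f0] by (auto simp: f_def)
    then show ?thesis
      unfolding vlat_hom_def by (auto intro!: f_eq rel_add rel_smult rel_vmeet rel_vjoin rel_f)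
  qed
  \<comment> \<open>The value of a truncation is known for positive elements, so positivity of the
    image has to be settled before f is shown to preserve truncation.\<close>
  then have "f x \<in> pos H" if "x \<in> pos G" for x
    using that vlat_hom_pos[OF G.vector_lattice_axioms H.vector_lattice_axioms] by blast
  with f_hom have "f \<in> trunc_hom G H"
    by (auto simp: trunc_hom_def intro!: f_eq rel_tr rel_f)
  moreover have "restrict f (unital_components G) = \<phi>"
  proof (rule ext)
    show "restrict f (unital_components G) u = \<phi> u" for u
      using f_eq[OF rel_unital[of u]] \<phi> by (auto simp: gba_hom_def PiE_def extensional_def)
  qed
  ultimately show ?thesis by blast
qed

section \<open>Truncs of step functions\<close>

text \<open>The carrier has to consist of elements of \<open>'u\<close>, while functions have a
  different type. So the pointwise structure on S is transported along a code \<open>enc\<close>,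
  which \<open>function_space\<close> takes to be injective on S.\<close>

definition function_trunc :: "('b \<Rightarrow> real) set \<Rightarrow> (('b \<Rightarrow> real) \<Rightarrow> 'u) \<Rightarrow> 'u trunc" where
  "function_trunc S enc = (let dec = inv_into S enc in
     \<lparr>carrier = enc ` S, monoid.mult = (\<lambda>x y. x), one = enc (\<lambda>p. 0), ring.zero = enc (\<lambda>p. 0),
      add = (\<lambda>x y. enc (\<lambda>p. dec x p + dec y p)), module.smult = (\<lambda>r x. enc (\<lambda>p. r * dec x p)),
      vle = (\<lambda>x y. \<forall>p. dec x p \<le> dec y p), truncation = (\<lambda>x. enc (\<lambda>p. min (dec x p) 1))\<rparr>)"

text \<open>The constant function 1 may lie outside S, so closure under truncation,
  \<open>trunc_in\<close>, is no instance of \<open>min_in\<close>.\<close>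

locale function_space =
  fixes S :: "('b \<Rightarrow> real) set" and enc :: "('b \<Rightarrow> real) \<Rightarrow> 'u"
  assumes inj: "inj_on enc S"
    and zero_in: "(\<lambda>p. 0) \<in> S"
    and add_in: "\<lbrakk>f \<in> S; g \<in> S\<rbrakk> \<Longrightarrow> (\<lambda>p. f p + g p) \<in> S"
    and smult_in: "f \<in> S \<Longrightarrow> (\<lambda>p. r * f p) \<in> S"
    and min_in: "\<lbrakk>f \<in> S; g \<in> S\<rbrakk> \<Longrightarrow> (\<lambda>p. min (f p) (g p)) \<in> S"
    and max_in: "\<lbrakk>f \<in> S; g \<in> S\<rbrakk> \<Longrightarrow> (\<lambda>p. max (f p) (g p)) \<in> S"
    and trunc_in: "f \<in> S \<Longrightarrow> (\<lambda>p. min (f p) 1) \<in> S"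
begin

abbreviation FT :: "'u trunc" where
  "FT \<equiv> function_trunc S enc"

lemma carrier_FT: "carrier FT = enc ` S"
  by (simp add: function_trunc_def Let_def)

lemma dec_enc [simp]: "f \<in> S \<Longrightarrow> inv_into S enc (enc f) = f"
  by (rule inv_into_f_f[OF inj])

lemma enc_eq [simp]: "\<lbrakk>f \<in> S; g \<in> S\<rbrakk> \<Longrightarrow> enc f = enc g \<longleftrightarrow> f = g"
  using inj by (auto simp: inj_on_def)

lemma FT_simps [simp]:
  "\<zero>\<^bsub>FT\<^esub> = enc (\<lambda>p. 0)"
  "\<lbrakk>f \<in> S; g \<in> S\<rbrakk> \<Longrightarrow> enc f \<oplus>\<^bsub>FT\<^esub> enc g = enc (\<lambda>p. f p + g p)"
  "f \<in> S \<Longrightarrow> r \<odot>\<^bsub>FT\<^esub> enc f = enc (\<lambda>p. r * f p)"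
  "\<lbrakk>f \<in> S; g \<in> S\<rbrakk> \<Longrightarrow> enc f \<preceq>\<^bsub>FT\<^esub> enc g \<longleftrightarrow> (\<forall>p. f p \<le> g p)"
  "f \<in> S \<Longrightarrow> truncation FT (enc f) = enc (\<lambda>p. min (f p) 1)"
  by (simp_all add: function_trunc_def Let_def)

lemma module_FT: "module (ring_of_type_algebra :: real ring) FT"
proof (rule moduleI)
  show "cring (ring_of_type_algebra :: real ring)" by (rule cring_from_type_algebra)
  show "abelian_group FT"
  proof (rule abelian_groupI)
    fix x assume "x \<in> carrier FT"
    then obtain f where f: "f \<in> S" "x = enc f" by (auto simp: carrier_FT)
    then show "\<exists>y\<in>carrier FT. y \<oplus>\<^bsub>FT\<^esub> x = \<zero>\<^bsub>FT\<^esub>"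
      using smult_in[of f "-1"] by (auto simp: carrier_FT intro!: bexI[of _ "\<lambda>p. - f p"])
  qed (auto simp: carrier_FT zero_in add_in add_ac)
qed (auto simp: carrier_FT real_ring_simps add_in smult_in algebra_simps)

lemma vorder_FT_simps [simp]:
  "carrier (vorder FT) = enc ` S" "le (vorder FT) = vle FT" "eq (vorder FT) = (=)"
  by (simp_all add: vorder_def carrier_FT)

lemma partial_order_FT: "partial_order (vorder FT)"
  by unfold_locales (auto simp: fun_eq_iff, meson order.antisym, meson order.trans)

lemma FT_meet:
  assumes "f \<in> S" "g \<in> S"
  shows "greatest (vorder FT) (enc (\<lambda>p. min (f p) (g p))) (Lower (vorder FT) {enc f, enc g})"
    and "enc f \<triangle>\<^bsub>FT\<^esub> enc g = enc (\<lambda>p. min (f p) (g p))"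
  by (rule partial_order.meet_eqI[OF partial_order_FT]; use assms in \<open>auto simp: min_in\<close>)+

lemma FT_join:
  assumes "f \<in> S" "g \<in> S"
  shows "least (vorder FT) (enc (\<lambda>p. max (f p) (g p))) (Upper (vorder FT) {enc f, enc g})"
  by (rule partial_order.join_eqI[OF partial_order_FT]; use assms in \<open>auto simp: max_in\<close>)

lemma lattice_FT: "lattice (vorder FT)"
proof -
  interpret partial_order "vorder FT" by (rule partial_order_FT)
  show ?thesis by unfold_locales (auto intro: FT_meet(1) FT_join)
qed

lemma pos_FT: "x \<in> pos FT \<longleftrightarrow> (\<exists>f\<in>S. x = enc f \<and> (\<forall>p. 0 \<le> f p))"
  by (auto simp: pos_def carrier_FT zero_in)

lemma trunc_FT: "trunc FT"
proof -
  have "vector_lattice FT"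
    unfolding vector_lattice_def vector_lattice_axioms_def
    using module_FT lattice_FT by (auto simp: carrier_FT pos_FT zero_in add_in smult_in)
  moreover have "f = (\<lambda>p. 0)"
    if "f \<in> S" "g \<in> S" "\<And>p. 0 \<le> f p" "\<And>n p. 0 < n \<Longrightarrow> real n * f p \<le> g p" for f g
  proof (rule ext, rule ccontr)
    fix p assume "f p \<noteq> 0"
    then have "0 < f p" using that(3)[of p] by simp
    then obtain n where "g p < real n * f p" using reals_Archimedean3 by blast
    \<comment> \<open>The index n may be 0, which the hypothesis does not cover;
      \<open>Suc n\<close> is always admissible and gives at least as large a multiple.\<close>
    moreover have "real n * f p \<le> real (Suc n) * f p" using that(3)[of p] by (simp add: mult_right_mono)
    ultimately show False using that(4)[of "Suc n" p] by linarith
  qed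
  then have "x = \<zero>\<^bsub>FT\<^esub>" if "x \<in> pos FT" "y \<in> pos FT"
    "\<And>n::nat. 0 < n \<Longrightarrow> real n \<odot>\<^bsub>FT\<^esub> x \<preceq>\<^bsub>FT\<^esub> y" for x y
    using that by (auto simp: pos_FT smult_in)
  ultimately have arch: "archimedean_vector_lattice FT"
    by (simp add: archimedean_vector_lattice_def archimedean_vector_lattice_axioms_def)
  have "f = (\<lambda>p. 0)" if "f \<in> S" "\<And>p. 0 \<le> f p" "(\<lambda>p. min (f p) 1) = (\<lambda>p. 0)" for f
  proof
    show "f p = 0" for p using that(2)[of p] fun_cong[OF that(3), of p] by (auto simp: min_def split: if_splits)
  qed
  then have eq_zero: "x = \<zero>\<^bsub>FT\<^esub>" if "x \<in> pos FT" "truncation FT x = \<zero>\<^bsub>FT\<^esub>" for x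
    using that by (auto simp: pos_FT trunc_in zero_in)
  have "f = (\<lambda>p. 0)"
    if "f \<in> S" "\<And>p. 0 \<le> f p"
      "\<And>n. 0 < n \<Longrightarrow> (\<lambda>p. real n * f p) = (\<lambda>p. min (real n * f p) 1)" for f
  proof (rule ext, rule ccontr)
    fix p assume "f p \<noteq> 0"
    then have "0 < f p" using that(2)[of p] by simp
    then obtain n where n: "1 < real n * f p" using reals_Archimedean3 by blast
    then have "0 < n" by (cases n) auto
    from fun_cong[OF that(3)[OF this], of p] n show False by simp
  qed
  then have bounded: "x = \<zero>\<^bsub>FT\<^esub>" if "x \<in> pos FT"
    "\<And>n::nat. 0 < n \<Longrightarrow> real n \<odot>\<^bsub>FT\<^esub> x = truncation FT (real n \<odot>\<^bsub>FT\<^esub> x)" for x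
    using that by (auto simp: pos_FT smult_in trunc_in)
  show ?thesis
    unfolding trunc_def trunc_axioms_def
    using arch eq_zero bounded by (auto simp: pos_FT trunc_in FT_meet min_in le_max_iff_disj min_le_iff_disj)
qed

lemma finsum_FT:
  assumes "finite I" "\<And>i. i \<in> I \<Longrightarrow> f i \<in> S"
  shows "(\<lambda>p. \<Sum>i\<in>I. f i p) \<in> S \<and> (\<Oplus>\<^bsub>FT\<^esub>i\<in>I. enc (f i)) = enc (\<lambda>p. \<Sum>i\<in>I. f i p)"
  using assms
proof (induction I rule: finite_induct)
  interpret module "ring_of_type_algebra :: real ring" FT by (rule module_FT)
  case empty
  then show ?case by (simp add: zero_in)
next
  interpret module "ring_of_type_algebra :: real ring" FT by (rule module_FT)
  case (insert i I)
  then show ?case by (auto simp: M.finsum_insert carrier_FT add_in)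
qed

end

section \<open>Step functions over a ring of sets\<close>

locale set_ring =
  fixes R :: "'b set set"
  assumes empty_in: "{} \<in> R"
    and Un_in: "\<lbrakk>A \<in> R; B \<in> R\<rbrakk> \<Longrightarrow> A \<union> B \<in> R"
    and Diff_in: "\<lbrakk>A \<in> R; B \<in> R\<rbrakk> \<Longrightarrow> A - B \<in> R"
begin

text \<open>The level set at 0 is exempt because a ring of sets need not contain the complements of
  its members.\<close>

definition step_functions :: "('b \<Rightarrow> real) set" where
  "step_functions = {f. finite (range f) \<and> (\<forall>r. r \<noteq> 0 \<longrightarrow> f -` {r} \<in> R)}"

lemma Int_in: "\<lbrakk>A \<in> R; B \<in> R\<rbrakk> \<Longrightarrow> A \<inter> B \<in> R"
  using Diff_in[of A "A - B"] Diff_in[of A B] by (simp add: Diff_Diff_Int)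

lemma UN_in: "\<lbrakk>finite I; \<And>i. i \<in> I \<Longrightarrow> A i \<in> R\<rbrakk> \<Longrightarrow> (\<Union>i\<in>I. A i) \<in> R"
  by (induction I rule: finite_induct) (auto simp: empty_in Un_in)

text \<open>Since h vanishes at the origin, a nonzero level of the combination is a finite union of
  intersections of levels of f and g in which the two zero levels never occur together.\<close>

lemma step_functions_combine:
  assumes f: "f \<in> step_functions" and g: "g \<in> step_functions" and h: "h 0 0 = (0::real)"
  shows "(\<lambda>p. h (f p) (g p)) \<in> step_functions"
proof -
  have fin: "finite (range f \<times> range g)" using f g by (simp add: step_functions_def)
  have "range (\<lambda>p. h (f p) (g p)) \<subseteq> (\<lambda>(s, t). h s t) ` (range f \<times> range g)" by auto
  then have "finite (range (\<lambda>p. h (f p) (g p)))" using fin by (rule finite_surj[rotated])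
  moreover have "(\<lambda>p. h (f p) (g p)) -` {r} \<in> R" if "r \<noteq> 0" for r
  proof -
    have supp: "{p. k p \<noteq> 0} \<in> R" if k: "k \<in> step_functions" for k
    proof -
      have "{p. k p \<noteq> 0} = (\<Union>s\<in>range k - {0}. k -` {s})" by auto
      also have "\<dots> \<in> R" using k by (intro UN_in) (auto simp: step_functions_def)
      finally show ?thesis .
    qed
    \<comment> \<open>A zero level need not be in R, but its intersection with a nonzero level of
      the other function is that level minus a support.\<close>
    have level: "f -` {s} \<inter> g -` {t} \<in> R" if "s \<noteq> 0 \<or> t \<noteq> 0" for s t
    proof -
      consider "s \<noteq> 0" "t \<noteq> 0" | "s = 0" "t \<noteq> 0" | "s \<noteq> 0" "t = 0" using \<open>s \<noteq> 0 \<or> t \<noteq> 0\<close> by blast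
      then show ?thesis
      proof cases
        case 1
        then show ?thesis using f g by (auto simp: step_functions_def intro: Int_in)
      next
        case 2
        then have "f -` {s} \<inter> g -` {t} = g -` {t} - {p. f p \<noteq> 0}" by auto
        then show ?thesis using g 2 supp[OF f] by (auto simp: step_functions_def intro: Diff_in)
      next
        case 3
        then have "f -` {s} \<inter> g -` {t} = f -` {s} - {p. g p \<noteq> 0}" by auto
        then show ?thesis using f 3 supp[OF g] by (auto simp: step_functions_def intro: Diff_in)
      qed
    qed
    have "(\<lambda>p. h (f p) (g p)) -` {r}
      = (\<Union>(s, t)\<in>{(s, t) \<in> range f \<times> range g. h s t = r}. f -` {s} \<inter> g -` {t})"
      by auto
    also have "\<dots> \<in> R"
    proof (rule UN_in)
      show "finite {(s, t) \<in> range f \<times> range g. h s t = r}"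
        by (rule finite_subset[OF _ fin]) auto
    next
      fix i assume "i \<in> {(s, t) \<in> range f \<times> range g. h s t = r}"
      then obtain s t where i: "i = (s, t)" and "h s t = r" by auto
      with h \<open>r \<noteq> 0\<close> have "s \<noteq> 0 \<or> t \<noteq> 0" by metis
      then show "(case i of (s, t) \<Rightarrow> f -` {s} \<inter> g -` {t}) \<in> R" using level i by simp
    qed
    finally show ?thesis .
  qed
  ultimately show ?thesis by (simp add: step_functions_def)
qed

lemma indicator_step_function: "A \<in> R \<Longrightarrow> indicator A \<in> step_functions"
proof -
  assume "A \<in> R"
  moreover have "range (indicator A :: 'b \<Rightarrow> real) \<subseteq> {0, 1}" by (auto simp: indicator_def)
  then have "finite (range (indicator A :: 'b \<Rightarrow> real))" by (rule finite_subset) simp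
  moreover have "(indicator A :: 'b \<Rightarrow> real) -` {r} = (if r = 1 then A else {})" if "r \<noteq> 0" for r
    using that by (auto simp: indicator_def split: if_splits)
  ultimately show ?thesis by (simp add: step_functions_def empty_in)
qed

lemma step_function_eq_sum:
  assumes "f \<in> step_functions"
  shows "f = (\<lambda>p. \<Sum>r\<in>range f - {0}. r * indicator (f -` {r}) p)"
proof
  fix p
  have fin: "finite (range f - {0})" using assms by (simp add: step_functions_def)
  have "(\<Sum>r\<in>range f - {0}. r * indicator (f -` {r}) p)
    = (\<Sum>r\<in>range f - {0}. if r = f p then f p else 0)"
    by (rule sum.cong) (auto simp: indicator_def)
  also have "\<dots> = f p" using fin by (auto simp: sum.delta)
  finally show "f p = (\<Sum>r\<in>range f - {0}. r * indicator (f -` {r}) p)" by simp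
qed

end

section \<open>The trunc of step functions and its unital components\<close>

locale step_function_trunc = set_ring R for R :: "'b set set" +
  fixes enc :: "('b \<Rightarrow> real) \<Rightarrow> 'u"
  assumes enc_inj: "inj_on enc step_functions"

sublocale step_function_trunc \<subseteq> function_space step_functions enc
proof
  have "(\<lambda>p. 0) = (indicator {} :: 'b \<Rightarrow> real)" by auto
  then show "(\<lambda>p. 0) \<in> step_functions" using indicator_step_function[OF empty_in] by simp
  fix f g assume f: "f \<in> step_functions" and g: "g \<in> step_functions"
  show "(\<lambda>p. f p + g p) \<in> step_functions" "(\<lambda>p. min (f p) (g p)) \<in> step_functions"
    "(\<lambda>p. max (f p) (g p)) \<in> step_functions"
    using step_functions_combine[OF f g] by simp_all
next
  fix f and r :: real assume f: "f \<in> step_functions"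
  show "(\<lambda>p. r * f p) \<in> step_functions" "(\<lambda>p. min (f p) 1) \<in> step_functions"
    using step_functions_combine[OF f f, of "\<lambda>s t. r * s"]
      step_functions_combine[OF f f, of "\<lambda>s t. min s 1"] by simp_all
qed (rule enc_inj)

context step_function_trunc
begin

text \<open>Pointwise, t = min (2t) 1 holds only for t = 0 and t = 1, so the equation for unital
  components singles out the indicators of members of R.\<close>

lemma unital_components_FT: "unital_components FT = (\<lambda>A. enc (indicator A)) ` R"
proof -
  interpret trunc FT by (rule trunc_FT)
  have iff: "enc f \<in> unital_components FT \<longleftrightarrow> f \<in> indicator ` R" if f: "f \<in> step_functions" for f
  proof
    assume "enc f \<in> unital_components FT"
    then have "(\<lambda>p. min (2 * f p) 1) = f"
      using f by (auto simp: unital_components_iff smult_in trunc_in)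
    then have "f p = 0 \<or> f p = 1" for p
      using fun_cong[of "\<lambda>p. min (2 * f p) 1" f p] by (auto simp: min_def split: if_splits)
    then have "f = indicator (f -` {1})" by (auto simp: fun_eq_iff indicator_def)
    moreover have "f -` {1} \<in> R" using f by (auto simp: step_functions_def)
    ultimately show "f \<in> indicator ` R" by blast
  next
    assume "f \<in> indicator ` R"
    then obtain A where A: "f = indicator A" by blast
    then have "(\<lambda>p. min (2 * f p) 1) = f" by (auto simp: fun_eq_iff indicator_def)
    moreover have "\<forall>p. 0 \<le> f p" using A by simp
    ultimately show "enc f \<in> unital_components FT"
      using f by (auto simp: unital_components_iff pos_FT smult_in trunc_in)
  qed
  have "unital_components FT \<subseteq> enc ` step_functions"
    using unital_pos pos_carrier by (auto simp flip: carrier_FT)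
  then have "x \<in> enc ` (indicator ` R)" if "x \<in> unital_components FT" for x
    using iff that by (metis image_iff subsetD)
  moreover have "enc (indicator A) \<in> unital_components FT" if "A \<in> R" for A
    using iff[OF indicator_step_function[OF that]] that by simp
  ultimately show ?thesis by (auto simp: image_image)
qed

text \<open>The combination is the canonical one over the nonzero levels. As
  \<open>simple_trunc\<close> indexes by the components themselves, the sum over values is reindexed
  along v, and the coefficient of a component is the value it comes from.\<close>

lemma simple_FT: "simple_trunc FT"
  unfolding simple_trunc_def
proof
  interpret module "ring_of_type_algebra :: real ring" FT by (rule module_FT)
  fix x assume "x \<in> carrier FT"
  then obtain f where f: "f \<in> step_functions" and x: "x = enc f" by (auto simp: carrier_FT)
  define I where "I = range f - {0}"
  define v where "v r = enc (indicator (f -` {r}))" for r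
  have I: "finite I" and R: "\<And>r. r \<in> I \<Longrightarrow> f -` {r} \<in> R"
    using f by (auto simp: I_def step_functions_def)
  note ind = indicator_step_function[OF R]
  \<comment> \<open>Levels of attained values are nonempty, and different values have disjoint
    levels.\<close>
  have v: "inj_on v I"
  proof (rule inj_onI)
    fix r s assume rs: "r \<in> I" "s \<in> I" "v r = v s"
    then have "(indicator (f -` {r}) :: _ \<Rightarrow> real) = indicator (f -` {s})"
      using ind by (simp add: v_def)
    moreover obtain p where p: "f p = r" using rs by (auto simp: I_def)
    ultimately have "indicator (f -` {r}) p = (indicator (f -` {s}) p :: real)" by simp
    then show "r = s" using p by (simp add: indicator_def)
  qed
  have "(\<Oplus>\<^bsub>FT\<^esub>u\<in>v ` I. inv_into I v u \<odot>\<^bsub>FT\<^esub> u) = (\<Oplus>\<^bsub>FT\<^esub>r\<in>I. inv_into I v (v r) \<odot>\<^bsub>FT\<^esub> v r)"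
    by (rule M.finsum_reindex) (use v ind in \<open>auto simp: carrier_FT v_def smult_in\<close>)
  also have "\<dots> = (\<Oplus>\<^bsub>FT\<^esub>r\<in>I. enc (\<lambda>p. r * indicator (f -` {r}) p))"
    by (rule M.finsum_cong') (use v ind in \<open>auto simp: carrier_FT smult_in\<close>,
        use ind v in \<open>simp add: v_def\<close>)
  also have "\<dots> = enc (\<lambda>p. \<Sum>r\<in>I. r * indicator (f -` {r}) p)"
    using finsum_FT[OF I, of "\<lambda>r p. r * indicator (f -` {r}) p"] ind smult_in by blast
  also have "\<dots> = x" using step_function_eq_sum[OF f] by (simp add: x I_def)
  finally have "x = (\<Oplus>\<^bsub>FT\<^esub>u\<in>v ` I. inv_into I v u \<odot>\<^bsub>FT\<^esub> u)" by simp
  moreover have "v ` I \<subseteq> unital_components FT" using R by (auto simp: unital_components_FT v_def)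
  ultimately show "\<exists>U c. finite U \<and> U \<subseteq> unital_components FT \<and>
      x = (\<Oplus>\<^bsub>FT\<^esub>u\<in>U. (c u :: real) \<odot>\<^bsub>FT\<^esub> u)"
    using I by blast
qed

end

text \<open>An infinite set is equinumerous with its square and with the set of its finite subsets.
  The embedding of the reals makes \<open>'u\<close> infinite and lets its square absorb the factor
  \<open>real\<close>.\<close>

lemma finite_set_coding:
  includes cardinal_syntax
  fixes \<iota> :: "real \<Rightarrow> 'u"
  assumes "inj \<iota>"
  obtains code :: "(real \<times> 'u) set \<Rightarrow> 'u" where "inj_on code {D. finite D}"
proof -
  have inf: "infinite (UNIV :: 'u set)"
    using assms finite_imageD[of \<iota> UNIV] infinite_UNIV_char_0 by (metis finite_subset subset_UNIV)
  then have inf2: "infinite (UNIV :: (real \<times> 'u) set)"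
    by (simp add: finite_prod)
  have "|UNIV :: real set| \<le>o |UNIV :: 'u set|"
    using assms by (intro card_of_ordLeqI[of \<iota>]) auto
  then have "|(UNIV :: real set) \<times> (UNIV :: 'u set)| \<le>o |(UNIV :: 'u set) \<times> (UNIV :: 'u set)|"
    by (rule card_of_Times_mono1)
  moreover have "|Fpow (UNIV :: (real \<times> 'u) set)| =o |UNIV :: (real \<times> 'u) set|"
    using inf2 by (rule card_of_Fpow_infinite)
  moreover have "|(UNIV :: 'u set) \<times> (UNIV :: 'u set)| =o |UNIV :: 'u set|"
    using inf by (rule card_of_Times_same_infinite)
  ultimately have "|Fpow (UNIV :: (real \<times> 'u) set)| \<le>o |UNIV :: 'u set|"
    by (metis UNIV_Times_UNIV ordIso_ordLeq_trans ordLeq_ordIso_trans)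
  then show ?thesis
    using that by (auto simp: Fpow_def simp flip: card_of_ordLeq)
qed

lemma step_function_coding:
  fixes \<iota> :: "real \<Rightarrow> 'u" and hat :: "'u \<Rightarrow> 'b set"
  assumes "inj \<iota>" "set_ring (hat ` A)"
  obtains enc :: "('b \<Rightarrow> real) \<Rightarrow> 'u" where "step_function_trunc (hat ` A) enc"
proof -
  interpret set_ring "hat ` A" by fact
  obtain code :: "(real \<times> 'u) set \<Rightarrow> 'u" where code: "inj_on code {D. finite D}"
    using finite_set_coding[OF assms(1)] by blast
  \<comment> \<open>Each nonzero value is paired with one chosen element whose image under
    \<open>hat\<close> is the level set; the value 0 stays implicit. Naming levels by elements keeps
    the record inside \<open>real \<times> 'u\<close>.\<close>
  define graph where "graph f = (\<lambda>r. (r, inv_into A hat (f -` {r}))) ` (range f - {0})" for f :: "'b \<Rightarrow> real"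
  have graph: "f p = r \<longleftrightarrow> (\<exists>a. (r, a) \<in> graph f \<and> p \<in> hat a)"
    if "f \<in> step_functions" "r \<noteq> 0" for f p r
  proof -
    have "hat (inv_into A hat (f -` {r})) = f -` {r}"
      using that by (intro f_inv_into_f) (simp add: step_functions_def)
    then have "p \<in> hat (inv_into A hat (f -` {r})) \<longleftrightarrow> f p = r" by auto
    then show ?thesis using that(2) by (auto simp: graph_def)
  qed
  have "inj_on graph step_functions"
  proof (rule inj_onI, rule ext)
    fix f g p assume "f \<in> step_functions" "g \<in> step_functions" "graph f = graph g"
    then have "f p = r \<longleftrightarrow> g p = r" if "r \<noteq> 0" for r using graph that by simp
    \<comment> \<open>If one of the two values is nonzero, it serves as r; otherwise both are
      0.\<close>
    then show "f p = g p" by metis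
  qed
  moreover have "graph ` step_functions \<subseteq> {D. finite D}"
    by (auto simp: graph_def step_functions_def)
  ultimately have "inj_on (code \<circ> graph) step_functions"
    using code by (auto intro: comp_inj_on inj_on_subset)
  then have "step_function_trunc (hat ` A) (code \<circ> graph)"
    by unfold_locales
  then show ?thesis by (rule that)
qed

section \<open>Stone representation\<close>

context generalized_boolean_algebra
begin

text \<open>The Stone map. The empty prime lies in no image.\<close>

definition hat :: "'a \<Rightarrow> 'a set set" where
  "hat a = {p \<in> primes L. a \<in> p}"

lemma hat_join: "\<lbrakk>a \<in> carrier L; b \<in> carrier L\<rbrakk> \<Longrightarrow> hat (a \<squnion> b) = hat a \<union> hat b"
  by (auto simp: hat_def primes_def)

lemma hat_meet: "\<lbrakk>a \<in> carrier L; b \<in> carrier L\<rbrakk> \<Longrightarrow> hat (a \<sqinter> b) = hat a \<inter> hat b"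
  by (auto simp: hat_def primes_def)

lemma hat_bottom: "hat \<bottom> = {}"
  by (auto simp: hat_def primes_def)

text \<open>Differences of images come from relative complements: the image of c is disjoint from
  that of b and has the same union with it as the image of a.\<close>

lemma set_ring_hat: "set_ring (hat ` carrier L)"
proof
  show "{} \<in> hat ` carrier L" using hat_bottom by (metis bottom_closed image_eqI)
  fix A B assume "A \<in> hat ` carrier L" "B \<in> hat ` carrier L"
  then obtain a b where ab: "a \<in> carrier L" "b \<in> carrier L" "A = hat a" "B = hat b" by blast
  then show "A \<union> B \<in> hat ` carrier L" by (auto simp flip: hat_join)
  obtain c where c: "c \<in> carrier L" "c \<squnion> b = a \<squnion> b" "c \<sqinter> b = \<bottom>"
    using relative_complement[OF ab(1,2)] by blast
  have "hat c \<union> hat b = hat a \<union> hat b" "hat c \<inter> hat b = {}"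
    using ab c by (simp_all flip: hat_join hat_meet add: hat_bottom)
  then have "A - B = hat c" using ab by blast
  then show "A - B \<in> hat ` carrier L" using c by blast
qed

text \<open>If a is not below b, the principal ideal of b misses a; a prime that contains a and
  avoids this ideal lies in \<open>hat a\<close> but not in \<open>hat b\<close>.\<close>

lemma hat_subset_iff:
  assumes a: "a \<in> carrier L" and b: "b \<in> carrier L"
  shows "hat a \<subseteq> hat b \<longleftrightarrow> a \<sqsubseteq> b"
proof
  assume "a \<sqsubseteq> b"
  then have "a = a \<sqinter> b" using a b by (simp add: le_iff_join[symmetric])
  then have "hat a = hat a \<inter> hat b" using hat_meet[OF a b] by simp
  then show "hat a \<subseteq> hat b" by blast
next
  assume sub: "hat a \<subseteq> hat b"
  show "a \<sqsubseteq> b"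
  proof (rule ccontr)
    assume nle: "\<not> a \<sqsubseteq> b"
    obtain p where "p \<in> primes L" "a \<in> p" "p \<inter> {c \<in> carrier L. c \<sqsubseteq> b} = {}"
    proof (rule prime_separation[of "{c \<in> carrier L. c \<sqsubseteq> b}" a])
      fix x y assume "x \<in> carrier L" "y \<in> {c \<in> carrier L. c \<sqsubseteq> b}" "x \<sqsubseteq> y"
      then show "x \<in> {c \<in> carrier L. c \<sqsubseteq> b}" using b by (auto intro: le_trans[of x y b])
    qed (use a b nle in \<open>auto intro: join_le\<close>)
    then show False using sub b by (auto simp: hat_def)
  qed
qed

end

text \<open>Meets, joins and the bottom are determined by the order, and surjectivity lets every
  competing bound in M be pulled back to L.\<close>

lemma order_iso_gba_hom:
  assumes L: "generalized_boolean_algebra L" and M: "generalized_boolean_algebra M"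
    and f: "f \<in> extensional (carrier L)" "bij_betw f (carrier L) (carrier M)"
    and le: "\<And>x y. \<lbrakk>x \<in> carrier L; y \<in> carrier L\<rbrakk> \<Longrightarrow> f x \<sqsubseteq>\<^bsub>M\<^esub> f y \<longleftrightarrow> x \<sqsubseteq>\<^bsub>L\<^esub> y"
  shows "f \<in> gba_hom L M"
proof -
  interpret L: generalized_boolean_algebra L by fact
  interpret M: generalized_boolean_algebra M by fact
  have closed [simp]: "f x \<in> carrier M" if "x \<in> carrier L" for x
    using f(2) that by (auto simp: bij_betw_def)
  have ex: "\<exists>x\<in>carrier L. z = f x" if "z \<in> carrier M" for z
    using f(2) that by (auto simp: bij_betw_def)
  have "f x \<sqinter>\<^bsub>M\<^esub> f y = f (x \<sqinter>\<^bsub>L\<^esub> y)" if "x \<in> carrier L" "y \<in> carrier L" for x y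
    by (rule M.meet_eqI) (use that in \<open>auto simp: le L.meet_left L.meet_right dest!: ex intro: L.meet_le\<close>)
  moreover have "f x \<squnion>\<^bsub>M\<^esub> f y = f (x \<squnion>\<^bsub>L\<^esub> y)" if "x \<in> carrier L" "y \<in> carrier L" for x y
    by (rule M.join_eqI) (use that in \<open>auto simp: le L.join_left L.join_right dest!: ex intro: L.join_le\<close>)
  moreover have "\<bottom>\<^bsub>M\<^esub> = f \<bottom>\<^bsub>L\<^esub>"
    by (rule M.bottom_eqI) (auto simp: le dest!: ex)
  ultimately show ?thesis using f(1) by (auto simp: gba_hom_def PiE_def)
qed

text \<open>The arrow is the inverse of f, from M to L, because essential surjectivity is stated
  with arrows out of the value of the functor.\<close>

lemma order_iso_iso_in:
  assumes L: "generalized_boolean_algebra L" and M: "generalized_boolean_algebra M"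
    and f: "bij_betw f (carrier L) (carrier M)"
    and le: "\<And>x y. \<lbrakk>x \<in> carrier L; y \<in> carrier L\<rbrakk> \<Longrightarrow> f x \<sqsubseteq>\<^bsub>M\<^esub> f y \<longleftrightarrow> x \<sqsubseteq>\<^bsub>L\<^esub> y"
  shows "iso_in gba_cat M L (restrict (inv_into (carrier L) f) (carrier M))"
proof -
  let ?f = "restrict f (carrier L)" and ?g = "restrict (inv_into (carrier L) f) (carrier M)"
  have g: "bij_betw (inv_into (carrier L) f) (carrier M) (carrier L)"
    using f by (rule bij_betw_inv_into)
  have closed: "f x \<in> carrier M" if "x \<in> carrier L" for x
    using f that by (auto simp: bij_betw_def)
  have closed': "inv_into (carrier L) f y \<in> carrier L" if "y \<in> carrier M" for y
    using g that by (auto simp: bij_betw_def)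
  have inv: "inv_into (carrier L) f (f x) = x" if "x \<in> carrier L" for x
    using f that by (simp add: bij_betw_inv_into_left)
  have inv': "f (inv_into (carrier L) f y) = y" if "y \<in> carrier M" for y
    using f that by (simp add: bij_betw_inv_into_right)
  have "?f \<in> gba_hom L M"
    using f le by (intro order_iso_gba_hom L M) (auto cong: bij_betw_cong)
  moreover have "?g \<in> gba_hom M L"
  proof (intro order_iso_gba_hom L M)
    show "?g x \<sqsubseteq>\<^bsub>L\<^esub> ?g y \<longleftrightarrow> x \<sqsubseteq>\<^bsub>M\<^esub> y" if "x \<in> carrier M" "y \<in> carrier M" for x y
      using le[OF closed' closed', OF that] that by (simp add: inv')
  qed (use g in \<open>auto cong: bij_betw_cong\<close>)
  moreover have "compose (carrier M) ?f ?g = (\<lambda>x\<in>carrier M. x)"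
    "compose (carrier L) ?g ?f = (\<lambda>x\<in>carrier L. x)"
    by (auto simp: fun_eq_iff compose_def closed closed' inv inv')
  ultimately show ?thesis unfolding iso_in_def by auto
qed

lemma UC_essentially_surjective:
  fixes \<iota> :: "real \<Rightarrow> 'u" and L :: "'u gorder"
  assumes "inj \<iota>" and L: "generalized_boolean_algebra L"
  shows "\<exists>G\<in>Obj simple_truncs_cat. \<exists>e. iso_in gba_cat (FObj UC G) L e"
proof -
  interpret L: generalized_boolean_algebra L by fact
  obtain enc :: "('u set \<Rightarrow> real) \<Rightarrow> 'u" where "step_function_trunc (L.hat ` carrier L) enc"
    using step_function_coding[OF assms(1) L.set_ring_hat] by blast
  then interpret step_function_trunc "L.hat ` carrier L" enc .
  interpret trunc FT by (rule trunc_FT)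
  define f where "f a = enc (indicator (L.hat a))" for a
  \<comment> \<open>Pointwise comparison of indicators is inclusion of sets, and inclusion of Stone
    images is the order of L.\<close>
  have le: "f a \<preceq>\<^bsub>FT\<^esub> f b \<longleftrightarrow> a \<sqsubseteq>\<^bsub>L\<^esub> b" if "a \<in> carrier L" "b \<in> carrier L" for a b
  proof -
    have "f a \<preceq>\<^bsub>FT\<^esub> f b \<longleftrightarrow> L.hat a \<subseteq> L.hat b"
      using that by (auto simp: f_def indicator_step_function indicator_def subset_iff)
    then show ?thesis using L.hat_subset_iff that by simp
  qed
  have "inj_on f (carrier L)"
  proof (rule inj_onI)
    fix a b assume ab: "a \<in> carrier L" "b \<in> carrier L" and eq: "f a = f b"
    then have "f a \<preceq>\<^bsub>FT\<^esub> f b" "f b \<preceq>\<^bsub>FT\<^esub> f a"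
      by (auto simp: f_def indicator_step_function)
    with ab show "a = b" by (simp add: le L.le_antisym)
  qed
  then have "bij_betw f (carrier L) (carrier (uc_lattice FT))"
    by (auto simp: bij_betw_def unital_components_FT f_def)
  then have "iso_in gba_cat (uc_lattice FT) L (restrict (inv_into (carrier L) f) (carrier (uc_lattice FT)))"
    using le by (intro order_iso_iso_in L uc_lattice_gba) auto
  then show ?thesis using trunc_FT simple_FT by (intro bexI[of _ FT]) auto
qed

theorem theorem7p5p1:
  fixes \<iota> :: "real \<Rightarrow> 'u"
  assumes "inj \<iota>"
  shows "equivalence_of_categories
    (simple_truncs_cat :: ('u trunc, 'u \<Rightarrow> 'u) cat) (gba_cat :: ('u gorder, 'u \<Rightarrow> 'u) cat) UC"
proof (rule equivalence_if_fully_faithful_essentially_surjective[OF UC_cat_functor])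
  fix G H :: "'u trunc"
  assume "G \<in> Obj simple_truncs_cat" "H \<in> Obj simple_truncs_cat"
  then have GH: "trunc G" "simple_trunc G" "trunc H" "simple_trunc H" by auto
  \<comment> \<open>One inclusion says that restrictions are homomorphisms, the other is
    fullness.\<close>
  have "(\<lambda>f. restrict f (unital_components G)) ` trunc_hom G H = gba_hom (uc_lattice G) (uc_lattice H)"
    using restrict_trunc_hom[OF GH(1,3)] UC_full[OF GH] by (auto simp: image_iff)
  then show "bij_betw (FMap UC G H) (Hom simple_truncs_cat G H) (Hom gba_cat (FObj UC G) (FObj UC H))"
    using UC_faithful[OF GH(1,2)] by (simp add: bij_betw_def inj_on_def image_def)
next
  fix L :: "'u gorder"
  assume "L \<in> Obj gba_cat"
  then show "\<exists>G\<in>Obj simple_truncs_cat. \<exists>e. iso_in gba_cat (FObj UC G) L e"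
    using UC_essentially_surjective[OF assms] by simp
qed

end
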